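(* Let $n\ge2$, $S\in\{1,\dots,n\}$, and $f=\frac1n\sum_{i=1}^nf_i$ where each $f_i:\mathbb{R}^d\to\mathbb{R}$ is proper, closed, convex, differentiable and $L_i$-smooth, $L_{\max}=\max_iL_i$, $f$ is $L$-smooth and attains its minimum, and there is $x_*\in\mathbb{R}^d$ with $\nabla f_i(x_* )=0$ for all $i$ (interpolation). Let $\gamma>0$ and assume that $M^\gamma$ satisfies the Polyak–Łojasiewicz condition with some constant $\mu_\gamma^+>0$: $$\tfrac12\|\nabla M^\gamma(x)\|^2\ge\mu_\gamma^+\big(M^\gamma(x)-M^\gamma(x_* )\big)\quad\text{for all }x\in\mathbb{R}^d.$$ Let $L_\gamma>0$ be a smoothness constant of $M^\gamma$ and $$L_{\gamma,S}=\frac{n-S}{S(n-1)}\frac{L_{\max}}{1+\gamma L_{\max}}+\frac{n(S-1)}{S(n-1)}L_\gamma>0 .$$ Then FedExProx with $S$-nice sampling started at $x_0\in\mathbb{R}^d$ with $\alpha=\frac{1}{\gamma L_{\gamma,S}}$ finds $\bar x$ with $\mathbb{E}[f(\bar x)]-f(x_* )\le\varepsilon$ in $$\mathcal{O}\left(\frac{L_{\gamma,S}}{\mu_\gamma^+}\log\frac1\varepsilon\right)$$ iterations; that is, there is a constant $C$ depending only on $L$ and $\|x_0-\Pi(x_0)\|$ such that for every $\varepsilon\in(0,\frac12]$ and every integer $K\ge C\frac{L_{\gamma,S}}{\mu_\gamma^+}\log\frac1\varepsilon$ the iterate $\bar x=x_K$ satisfies $\mathbb{E}[f(\bar x)]-f(x_*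 )\le\varepsilon$.
   Context: A function is $L$-smooth if its gradient is $L$-Lipschitz. For a convex function $g$ and $\gamma>0$, $\mathrm{prox}_{\gamma g}(x)=\arg\min_z\{g(z)+\frac1{2\gamma}\|z-x\|^2\}$ and $M_g^\gamma(x)=\min_z\{g(z)+\frac1{2\gamma}\|z-x\|^2\}$ (Moreau envelope). $M^\gamma=\frac1n\sum_{i=1}^nM^\gamma_{f_i}$. FedExProx with $S$-nice sampling: at each iteration $k$ sample, independently of the past, a subset $\mathcal{S}_k\subseteq\{1,\dots,n\}$ uniformly from all subsets of cardinality $S$, and set $x_{k+1}=x_k+\alpha\big(\frac1S\sum_{i\in\mathcal{S}_k}\mathrm{prox}_{\gamma f_i}(x_k)-x_k\big)$. $\mathcal{X}_*=\{x:\nabla f_i(x)=0\ \forall i\}$ and $\Pi$ is the Euclidean projection onto $\mathcal{X}_*$. *)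

theory Defs
  imports "HOL-Probability.Probability"
begin

text \<open>
  The constant in the iteration bound must not depend on the dimension d, so d has to be a
  natural number quantified inside the formula, and R^d cannot be a type indexed by its dimension.
  All the spaces R^d are therefore realised inside one inner product space, the finitely supported
  real sequences, as the subspaces of the sequences that vanish from index d on.
\<close>

typedef fseq = "{x :: nat \<Rightarrow> real. finite {i. x i \<noteq> 0}}"
  morphisms coord Abs_fseq
  by (rule exI[of _ "\<lambda>_. 0"]) simp

setup_lifting type_definition_fseq

lemma finite_coord: "finite {i. coord x i \<noteq> 0}"
  using coord[of x] by simp

lemma fseq_eqI: "(\<And>i. coord x i = coord y i) \<Longrightarrow> x = y"
  by (rule iffD1[OF coord_inject], rule ext)

instantiation fseq :: real_vector
begin

lift_definition zero_fseq :: fseq is "\<lambda>_. 0"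
  by simp

lift_definition plus_fseq :: "fseq \<Rightarrow> fseq \<Rightarrow> fseq" is "\<lambda>x y i. x i + y i"
proof -
  fix x y :: "nat \<Rightarrow> real"
  assume "finite {i. x i \<noteq> 0}" "finite {i. y i \<noteq> 0}"
  then have "finite ({i. x i \<noteq> 0} \<union> {i. y i \<noteq> 0})" by simp
  then show "finite {i. x i + y i \<noteq> 0}" by (rule rev_finite_subset) auto
qed

lift_definition uminus_fseq :: "fseq \<Rightarrow> fseq" is "\<lambda>x i. - x i"
  by simp

lift_definition minus_fseq :: "fseq \<Rightarrow> fseq \<Rightarrow> fseq" is "\<lambda>x y i. x i - y i"
proof -
  fix x y :: "nat \<Rightarrow> real"
  assume "finite {i. x i \<noteq> 0}" "finite {i. y i \<noteq> 0}"
  then have "finite ({i. x i \<noteq> 0} \<union> {i. y i \<noteq> 0})" by simp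
  then show "finite {i. x i - y i \<noteq> 0}" by (rule rev_finite_subset) auto
qed

lift_definition scaleR_fseq :: "real \<Rightarrow> fseq \<Rightarrow> fseq" is "\<lambda>r x i. r * x i"
proof -
  fix r :: real and x :: "nat \<Rightarrow> real"
  assume "finite {i. x i \<noteq> 0}"
  then show "finite {i. r * x i \<noteq> 0}"
    by (rule rev_finite_subset) auto
qed

instance
  by standard (rule fseq_eqI, simp add: zero_fseq.rep_eq plus_fseq.rep_eq uminus_fseq.rep_eq
      minus_fseq.rep_eq scaleR_fseq.rep_eq algebra_simps)+

end

lemma coord_simps [simp]:
  "coord 0 i = 0"
  "coord (x + y) i = coord x i + coord y i"
  "coord (- x) i = - coord x i"
  "coord (x - y) i = coord x i - coord y i"
  "coord (r *\<^sub>R x) i = r * coord x i"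
  by (simp_all add: zero_fseq.rep_eq plus_fseq.rep_eq uminus_fseq.rep_eq
      minus_fseq.rep_eq scaleR_fseq.rep_eq)

lemma sum_support_extend:
  assumes "finite A" "{i. coord x i \<noteq> 0} \<subseteq> A"
  shows "(\<Sum>i | coord x i \<noteq> 0. coord x i * c i) = (\<Sum>i\<in>A. coord x i * c i)"
  using assms by (intro sum.mono_neutral_left) auto

instantiation fseq :: real_inner
begin

definition inner_fseq :: "fseq \<Rightarrow> fseq \<Rightarrow> real" where
  "inner_fseq x y = (\<Sum>i | coord x i \<noteq> 0. coord x i * coord y i)"

definition norm_fseq :: "fseq \<Rightarrow> real" where
  "norm_fseq x = sqrt (inner x x)"

definition dist_fseq :: "fseq \<Rightarrow> fseq \<Rightarrow> real" where
  "dist_fseq x y = norm (x - y)"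

definition sgn_fseq :: "fseq \<Rightarrow> fseq" where
  "sgn_fseq x = inverse (norm x) *\<^sub>R x"

definition uniformity_fseq :: "(fseq \<times> fseq) filter" where
  "uniformity_fseq = (INF e\<in>{0<..}. principal {(x, y). dist x y < e})"

definition open_fseq :: "fseq set \<Rightarrow> bool" where
  "open_fseq U = (\<forall>x\<in>U. eventually (\<lambda>(x', y). x' = x \<longrightarrow> y \<in> U) uniformity)"

instance
proof
  fix x y z :: fseq and r :: real and U :: "fseq set"
  show "dist x y = norm (x - y)" by (rule dist_fseq_def)
  show "sgn x = x /\<^sub>R norm x" by (rule sgn_fseq_def)
  show "uniformity = (INF e\<in>{0<..}. principal {(x::fseq, y). dist x y < e})"
    by (rule uniformity_fseq_def)
  show "open U = (\<forall>x\<in>U. eventually (\<lambda>(x', y). x' = x \<longrightarrow> y \<in> U) uniformity)"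
    by (rule open_fseq_def)
  show "norm x = sqrt (inner x x)" by (rule norm_fseq_def)
  let ?A = "{i. coord x i \<noteq> 0} \<union> {i. coord y i \<noteq> 0}"
  have fin: "finite ?A" by (simp add: finite_coord)
  show "inner x y = inner y x"
  proof -
    have "inner x y = (\<Sum>i\<in>?A. coord x i * coord y i)"
      unfolding inner_fseq_def by (rule sum_support_extend[OF fin]) auto
    moreover have "inner y x = (\<Sum>i\<in>?A. coord y i * coord x i)"
      unfolding inner_fseq_def by (rule sum_support_extend[OF fin]) auto
    ultimately show ?thesis by (simp add: mult.commute)
  qed
  show "inner (x + y) z = inner x z + inner y z"
  proof -
    have "inner (x + y) z = (\<Sum>i\<in>?A. coord (x + y) i * coord z i)"
      unfolding inner_fseq_def by (rule sum_support_extend[OF fin]) auto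
    moreover have "inner x z = (\<Sum>i\<in>?A. coord x i * coord z i)"
      unfolding inner_fseq_def by (rule sum_support_extend[OF fin]) auto
    moreover have "inner y z = (\<Sum>i\<in>?A. coord y i * coord z i)"
      unfolding inner_fseq_def by (rule sum_support_extend[OF fin]) auto
    ultimately show ?thesis by (simp add: sum.distrib distrib_right)
  qed
  show "inner (r *\<^sub>R x) y = r * inner x y"
  proof -
    have "inner (r *\<^sub>R x) y = (\<Sum>i\<in>?A. coord (r *\<^sub>R x) i * coord y i)"
      unfolding inner_fseq_def by (rule sum_support_extend[OF fin]) auto
    moreover have "inner x y = (\<Sum>i\<in>?A. coord x i * coord y i)"
      unfolding inner_fseq_def by (rule sum_support_extend[OF fin]) auto
    ultimately show ?thesis by (simp add: sum_distrib_left mult.assoc)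
  qed
  show "0 \<le> inner x x"
    unfolding inner_fseq_def by (simp add: sum_nonneg)
  show "inner x x = 0 \<longleftrightarrow> x = 0"
  proof
    assume "inner x x = 0"
    then have "coord x i = 0" for i
      unfolding inner_fseq_def
      by (subst (asm) sum_nonneg_eq_0_iff) (auto simp: finite_coord)
    then show "x = 0" by (intro fseq_eqI) simp
  next
    assume "x = 0"
    then have "coord x = (\<lambda>_. 0)" by (intro ext) simp
    then show "inner x x = 0" unfolding inner_fseq_def by simp
  qed
qed

end

definition Rspace :: "nat \<Rightarrow> fseq set" where
  "Rspace d = {x. \<forall>i\<ge>d. coord x i = 0}"

text \<open>The subspace \<^term>\<open>Rspace d\<close> is R^d with its usual inner product.\<close>

lemma subspace_Rspace: "subspace (Rspace d)"
  by (auto simp: subspace_def Rspace_def)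

lemma bij_betw_Rspace:
  "bij_betw (\<lambda>x. restrict (coord x) {..<d}) (Rspace d) ({..<d} \<rightarrow>\<^sub>E UNIV)"
proof (rule bij_betwI')
  fix x y assume xy: "x \<in> Rspace d" "y \<in> Rspace d"
  show "(restrict (coord x) {..<d} = restrict (coord y) {..<d}) = (x = y)"
  proof
    assume eq: "restrict (coord x) {..<d} = restrict (coord y) {..<d}"
    show "x = y"
    proof (rule fseq_eqI)
      fix i show "coord x i = coord y i"
        using fun_cong[OF eq, of i] xy by (cases "i < d") (auto simp: Rspace_def)
    qed
  qed simp
next
  fix a :: "nat \<Rightarrow> real" assume a: "a \<in> {..<d} \<rightarrow>\<^sub>E UNIV"
  let ?b = "\<lambda>i. if i < d then a i else 0"
  have "finite {i. ?b i \<noteq> 0}"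
    by (rule finite_subset[of _ "{..<d}"]) (auto split: if_splits)
  then have "coord (Abs_fseq ?b) = ?b"
    by (simp add: Abs_fseq_inverse)
  then have "Abs_fseq ?b \<in> Rspace d" "a = restrict (coord (Abs_fseq ?b)) {..<d}"
    using a by (auto simp: Rspace_def fun_eq_iff PiE_def extensional_def)
  then show "\<exists>x\<in>Rspace d. a = restrict (coord x) {..<d}" by blast
qed simp

lemma inner_Rspace:
  assumes "x \<in> Rspace d"
  shows "inner x y = (\<Sum>i<d. coord x i * coord y i)"
proof -
  have "{i. coord x i \<noteq> 0} \<subseteq> {..<d}"
  proof
    fix i assume "i \<in> {i. coord x i \<noteq> 0}"
    then have "\<not> d \<le> i" using assms by (auto simp: Rspace_def)
    then show "i \<in> {..<d}" by simp
  qed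
  then show ?thesis
    unfolding inner_fseq_def by (rule sum_support_extend[OF finite_lessThan])
qed

text \<open>
  Functions on R^d are functions on the ambient space of which only the values on the subspace V
  matter. The derivative within V determines a gradient only up to the orthogonal complement
  of V, hence the condition that it lies in V, which makes it unique.
\<close>

definition gradient_on :: "'a::real_inner set \<Rightarrow> ('a \<Rightarrow> real) \<Rightarrow> 'a \<Rightarrow> 'a" where
  "gradient_on V f x = (THE g. g \<in> V \<and> (f has_derivative (\<lambda>h. inner g h)) (at x within V))"

definition L_smooth_on :: "'a::real_inner set \<Rightarrow> real \<Rightarrow> ('a \<Rightarrow> real) \<Rightarrow> bool" where
  "L_smooth_on V L f \<longleftrightarrow> f differentiable_on V \<and> L-lipschitz_on V (gradient_on V f)"

definition prox :: "'a::real_inner set \<Rightarrow> real \<Rightarrow> ('a \<Rightarrow> real) \<Rightarrow> 'a \<Rightarrow> 'a" where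
  "prox V \<gamma> g x = (ARG_MIN (\<lambda>z. g z + 1 / (2 * \<gamma>) * (norm (z - x))\<^sup>2) z. z \<in> V)"

text \<open>The infimum is attained whenever g is convex and closed.\<close>

definition moreau :: "'a::real_inner set \<Rightarrow> real \<Rightarrow> ('a \<Rightarrow> real) \<Rightarrow> 'a \<Rightarrow> real" where
  "moreau V \<gamma> g x = (INF z\<in>V. g z + 1 / (2 * \<gamma>) * (norm (z - x))\<^sup>2)"

text \<open>The library's \<^const>\<open>closest_point\<close> needs a Heine-Borel space.\<close>

definition proj :: "'a::real_inner set \<Rightarrow> 'a \<Rightarrow> 'a" where
  "proj X x = (ARG_MIN (\<lambda>y. norm (x - y)) y. y \<in> X)"

definition average :: "nat \<Rightarrow> (nat \<Rightarrow> 'a \<Rightarrow> real) \<Rightarrow> 'a \<Rightarrow> real" where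
  "average n F x = 1 / real n * (\<Sum>i\<in>{1..n}. F i x)"

definition common_critical ::
  "'a::real_inner set \<Rightarrow> nat \<Rightarrow> (nat \<Rightarrow> 'a \<Rightarrow> real) \<Rightarrow> 'a set" where
  "common_critical V n F = {x \<in> V. \<forall>i\<in>{1..n}. gradient_on V (F i) x = 0}"

definition nice_smoothness :: "nat \<Rightarrow> nat \<Rightarrow> real \<Rightarrow> real \<Rightarrow> real \<Rightarrow> real" where
  "nice_smoothness n S \<gamma> Lmax L\<^sub>\<gamma> =
     (real n - real S) / (real S * (real n - 1)) * (Lmax / (1 + \<gamma> * Lmax))
     + real n * (real S - 1) / (real S * (real n - 1)) * L\<^sub>\<gamma>"

definition nice_sampling :: "nat \<Rightarrow> nat \<Rightarrow> nat set pmf" where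
  "nice_sampling n S = pmf_of_set {T. T \<subseteq> {1..n} \<and> card T = S}"

text \<open>
  The distribution of the k-th iterate. Each step draws its subset from a fresh copy of
  \<^const>\<open>nice_sampling\<close>, so the subsets are independent of the past.
\<close>

primrec fedexprox ::
  "'a::real_inner set \<Rightarrow> nat \<Rightarrow> nat \<Rightarrow> (nat \<Rightarrow> 'a \<Rightarrow> real) \<Rightarrow> real \<Rightarrow> real \<Rightarrow> 'a \<Rightarrow> nat \<Rightarrow> 'a pmf" where
  "fedexprox V n S F \<gamma> \<alpha> x0 0 = return_pmf x0"
| "fedexprox V n S F \<gamma> \<alpha> x0 (Suc k) =
     bind_pmf (fedexprox V n S F \<gamma> \<alpha> x0 k) (\<lambda>x.
     map_pmf (\<lambda>T. x + \<alpha> *\<^sub>R ((1 / real S) *\<^sub>R (\<Sum>i\<in>T. prox V \<gamma> (F i) x) - x))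
       (nice_sampling n S))"

end

theory Submission
  imports Defs
begin

text \<open>
  With g i x = (x - prox x) / \<gamma>, the gradient of the i-th Moreau envelope, a step is stochastic gradient
  descent on M with step size 1 / \<Lambda>, \<Lambda> = \<^const>\<open>nice_smoothness\<close>. Let q be the
  projection of x onto the solution set and p = \<open>\<langle>\<nabla>M(x), x - q\<rangle>\<close>. Since g i x is the gradient of
  F i at its proximal point, cocoercivity bounds the average of |g i x|^2 by Lmax / (1 + \<gamma> Lmax) p and
  \<open>|\<nabla>M(x)|\<^sup>2\<close> by the smoothness constant of M times p; these enter the second moment
  of the sampled gradient with precisely the weights in \<Lambda>, so the expected squared distance to q drops
  by at least p / \<Lambda>. Finally \<open>p \<ge> M(x) - M(q) \<ge> (\<mu>/8) |x - q|\<^sup>2\<close>: the first by convexity, the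
  second because under the Polyak-Lojasiewicz condition the path of gradient descent on M from x has finite
  length and ends at a solution. So the expected squared distance contracts by 1 - \<mu> / (8 \<Lambda>), and
  f is at most L/2 times the squared distance above its minimum. The initial value L/2 D^2 is absorbed into
  the factor of ln (1/\<epsilon>) because ln (1/\<epsilon>) \<ge> ln 2.
\<close>

hide_const (open) Tree.complete

section \<open>Completeness of the subspaces \<open>Rspace d\<close>\<close>

lemma coord_le_norm: "\<bar>coord x i\<bar> \<le> norm x"
proof (cases "coord x i = 0")
  case False
  have "(coord x i)\<^sup>2 \<le> inner x x"
    unfolding inner_fseq_def power2_eq_square
    using False finite_coord by (intro member_le_sum) auto
  then show ?thesis
    by (simp add: norm_eq_sqrt_inner real_le_rsqrt)
qed simp

text \<open>The ambient space of finitely supported sequences is not complete. Inside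
  \<open>Rspace d\<close> a Cauchy sequence converges coordinatewise to a sequence that vanishes
  from index d on, hence has finite support, and convergence in norm involves only d
  coordinates.\<close>

lemma complete_Rspace: "complete (Rspace d)"
  unfolding complete_def
proof (intro allI impI)
  fix X :: "nat \<Rightarrow> fseq"
  assume X: "(\<forall>k. X k \<in> Rspace d) \<and> Cauchy X"
  have "Cauchy (\<lambda>k. coord (X k) i)" for i
  proof (rule CauchyI)
    fix e :: real assume "e > 0"
    with X obtain N where N: "\<And>j k. j \<ge> N \<Longrightarrow> k \<ge> N \<Longrightarrow> norm (X j - X k) < e"
      using CauchyD by blast
    have "norm (coord (X j) i - coord (X k) i) < e" if "j \<ge> N" "k \<ge> N" for j k
      using coord_le_norm[of "X j - X k" i] N[OF that] by simp
    then show "\<exists>N. \<forall>j\<ge>N. \<forall>k\<ge>N. norm (coord (X j) i - coord (X k) i) < e"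
      by blast
  qed
  then have "\<exists>l. (\<lambda>k. coord (X k) i) \<longlonglongrightarrow> l" for i
    using Cauchy_convergent_iff convergent_def by blast
  then obtain l where l: "\<And>i. (\<lambda>k. coord (X k) i) \<longlonglongrightarrow> l i" by metis
  have l0: "l i = 0" if "i \<ge> d" for i
  proof (rule LIMSEQ_unique[OF l])
    show "(\<lambda>k. coord (X k) i) \<longlonglongrightarrow> 0" using X that by (simp add: Rspace_def)
  qed
  have "finite {i. l i \<noteq> 0}"
    by (rule finite_subset[of _ "{..<d}"]) (use l0 not_le in auto)
  then have c: "coord (Abs_fseq l) = l" by (simp add: Abs_fseq_inverse)
  have V: "Abs_fseq l \<in> Rspace d" using l0 by (simp add: Rspace_def c)
  have n: "norm (X k - Abs_fseq l) = sqrt (\<Sum>i<d. (coord (X k) i - l i)\<^sup>2)" for k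
    using inner_Rspace[of "X k - Abs_fseq l" d] X subspace_diff[OF subspace_Rspace _ V, of "X k"]
    by (simp add: norm_eq_sqrt_inner c power2_eq_square)
  have "(\<lambda>k. norm (X k - Abs_fseq l)) \<longlonglongrightarrow> sqrt (\<Sum>i<d. (l i - l i)\<^sup>2)"
    unfolding n by (intro tendsto_intros l)
  then have "X \<longlonglongrightarrow> Abs_fseq l"
    by (simp add: tendsto_norm_zero_iff LIM_zero_iff)
  then show "\<exists>l\<in>Rspace d. X \<longlonglongrightarrow> l" using V by blast
qed

section \<open>Minimisation on complete sets\<close>

text \<open>Completeness replaces compactness. The midpoint value is at least the infimum, so by
  \<open>strong\<close> the squared distance of two almost minimal points is controlled by their
  excess, and a minimizing sequence is Cauchy. Projections, Riesz vectors and proximal points are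
  all obtained from this.\<close>

lemma strongly_convex_attains_min:
  fixes \<phi> :: "'a::real_inner \<Rightarrow> real"
  assumes "complete A" "A \<noteq> {}" and cont: "continuous_on A \<phi>" and bdd: "bdd_below (\<phi> ` A)"
    and "c > 0"
    and mid: "\<And>y z. y \<in> A \<Longrightarrow> z \<in> A \<Longrightarrow> (1/2) *\<^sub>R (y + z) \<in> A"
    and strong: "\<And>y z. y \<in> A \<Longrightarrow> z \<in> A \<Longrightarrow>
      \<phi> ((1/2) *\<^sub>R (y + z)) \<le> (\<phi> y + \<phi> z) / 2 - c * (norm (y - z))\<^sup>2"
  shows "\<exists>x\<in>A. \<forall>y\<in>A. \<phi> x \<le> \<phi> y"
proof -
  define m where "m = (INF z\<in>A. \<phi> z)"
  have m: "m \<le> \<phi> z" if "z \<in> A" for z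
    unfolding m_def by (rule cINF_lower[OF bdd that])
  have "\<exists>z\<in>A. \<phi> z < m + 1 / real (Suc k)" for k
    unfolding m_def using cINF_less_iff[OF \<open>A \<noteq> {}\<close> bdd, of "m + 1 / real (Suc k)"]
    by (simp add: m_def)
  then obtain z where zA: "\<And>k. z k \<in> A" and z: "\<And>k. \<phi> (z k) < m + 1 / real (Suc k)"
    by metis
  have dist: "c * (norm (z j - z k))\<^sup>2 < (1 / real (Suc j) + 1 / real (Suc k)) / 2" for j k
    using strong[OF zA zA, of j k] m[OF mid[OF zA zA], of j k] z[of j] z[of k] by argo
  have "Cauchy z"
  proof (rule CauchyI)
    fix e :: real assume "e > 0"
    then have "c * e\<^sup>2 > 0" using \<open>c > 0\<close> by simp
    then obtain N where N: "1 / real (Suc N) < c * e\<^sup>2"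
      using nat_approx_posE by blast
    have "norm (z j - z k) < e" if "j \<ge> N" "k \<ge> N" for j k
    proof -
      have "1 / real (Suc j) \<le> 1 / real (Suc N)" "1 / real (Suc k) \<le> 1 / real (Suc N)"
        using that by (simp_all add: frac_le)
      then have "(1 / real (Suc j) + 1 / real (Suc k)) / 2 \<le> 1 / real (Suc N)"
        by argo
      with dist[of j k] N have "c * (norm (z j - z k))\<^sup>2 < c * e\<^sup>2"
        by (meson less_le_trans order.strict_trans)
      then have "(norm (z j - z k))\<^sup>2 < e\<^sup>2" using \<open>c > 0\<close> by simp
      then show ?thesis using \<open>e > 0\<close> by (meson less_imp_le power_less_imp_less_base)
    qed
    then show "\<exists>N. \<forall>j\<ge>N. \<forall>k\<ge>N. norm (z j - z k) < e" by blast
  qed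
  then obtain x where x: "x \<in> A" "z \<longlonglongrightarrow> x"
    using \<open>complete A\<close> zA unfolding complete_def by blast
  have "(\<lambda>k. \<phi> (z k)) \<longlonglongrightarrow> \<phi> x"
    using continuous_on_tendsto_compose[OF cont x(2,1)] zA by simp
  moreover have "(\<lambda>k. m + 1 / real (Suc k)) \<longlonglongrightarrow> m + 0"
    by (intro tendsto_add tendsto_const lim_1_over_n[THEN LIMSEQ_Suc])
  ultimately have "\<phi> x \<le> m + 0"
    by (rule LIMSEQ_le) (use z less_imp_le in blast)
  then show ?thesis using x(1) m by force
qed

text \<open>The parallelogram law centred at x, the source of the quadratic gain in every use of
  \<open>strongly_convex_attains_min\<close>.\<close>

lemma norm_midpoint_sq:
  fixes y z x :: "'a::real_inner"
  shows "(norm ((1/2) *\<^sub>R (y + z) - x))\<^sup>2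
    = ((norm (y - x))\<^sup>2 + (norm (z - x))\<^sup>2) / 2 - (1/4) * (norm (y - z))\<^sup>2"
  unfolding power2_norm_eq_inner
  by (simp add: inner_diff_left inner_diff_right inner_add_left inner_add_right inner_commute
      field_simps)

text \<open>The squared distance is minimized because, unlike the distance, it is strongly
  convex.\<close>

lemma closest_point_exists_complete:
  fixes A :: "'a::real_inner set"
  assumes "complete A" "A \<noteq> {}" "convex A"
  shows "\<exists>p\<in>A. \<forall>y\<in>A. norm (x - p) \<le> norm (x - y)"
proof -
  have "\<exists>p\<in>A. \<forall>y\<in>A. (norm (p - x))\<^sup>2 \<le> (norm (y - x))\<^sup>2"
  proof (rule strongly_convex_attains_min[OF assms(1,2), where c = "1/4"])
    show "continuous_on A (\<lambda>y. (norm (y - x))\<^sup>2)" by (intro continuous_intros)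
    show "bdd_below ((\<lambda>y. (norm (y - x))\<^sup>2) ` A)" by (rule bdd_belowI2[of _ 0]) simp
    show "(1/2) *\<^sub>R (y + z) \<in> A" if "y \<in> A" "z \<in> A" for y z
      using convexD[OF \<open>convex A\<close> that, of "1/2" "1/2"] by (simp add: scaleR_add_right)
  qed (simp_all add: norm_midpoint_sq)
  then show ?thesis
    by (simp add: norm_minus_commute abs_le_square_iff[symmetric])
qed

text \<open>The representing vector minimizes |z|^2 / 2 - D z over V; stationarity along h in V is
  exactly the representation of D h.\<close>

lemma riesz_complete_subspace:
  fixes V :: "'a::real_inner set"
  assumes "complete V" "subspace V" "bounded_linear D"
  shows "\<exists>g\<in>V. \<forall>h\<in>V. D h = inner g h"
proof -
  interpret D: bounded_linear D by fact
  define \<phi> where "\<phi> z = (1/2) * (norm z)\<^sup>2 - D z" for z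
  have "\<exists>g\<in>V. \<forall>y\<in>V. \<phi> g \<le> \<phi> y"
  proof (rule strongly_convex_attains_min[OF assms(1), where c = "1/8"])
    show "V \<noteq> {}" using subspace_0[OF assms(2)] by blast
    show "continuous_on V \<phi>"
      unfolding \<phi>_def by (intro continuous_intros D.continuous_on)
    show "bdd_below (\<phi> ` V)"
    proof -
      obtain K where K: "\<And>z. norm (D z) \<le> norm z * K" using D.bounded by blast
      have "- K\<^sup>2 / 2 \<le> \<phi> z" for z
      proof -
        have "0 \<le> (norm z - K)\<^sup>2" by simp
        with K[of z] show ?thesis unfolding \<phi>_def power2_diff by (simp add: abs_le_iff)
      qed
      then show ?thesis by (rule bdd_belowI2)
    qed
    show "(1/2) *\<^sub>R (y + z) \<in> V" if "y \<in> V" "z \<in> V" for y z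
      using that assms(2) by (simp add: subspace_add subspace_scale)
    show "\<phi> ((1/2) *\<^sub>R (y + z)) \<le> (\<phi> y + \<phi> z) / 2 - 1/8 * (norm (y - z))\<^sup>2" for y z
      using norm_midpoint_sq[of y z 0] unfolding \<phi>_def
      by (simp only: D.scaleR D.add diff_zero) (simp add: field_simps)
  qed simp
  then obtain g where g: "g \<in> V" "\<And>y. y \<in> V \<Longrightarrow> \<phi> g \<le> \<phi> y" by blast
  have "D h = inner g h" if h: "h \<in> V" for h
  proof -
    have exp: "\<phi> (g + t *\<^sub>R h) = \<phi> g + t * (inner g h - D h) + t\<^sup>2 / 2 * (norm h)\<^sup>2" for t
      unfolding \<phi>_def power2_norm_eq_inner
      by (simp add: D.add D.scaleR inner_add_left inner_add_right inner_commute
          power2_eq_square field_simps)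
    have "((\<lambda>t. \<phi> (g + t *\<^sub>R h)) has_real_derivative (inner g h - D h)) (at 0)"
      unfolding exp by (auto intro!: derivative_eq_intros)
    from DERIV_local_min[OF this zero_less_one] have "inner g h - D h = 0"
      using g(2)[of "g + _ *\<^sub>R h"] g(1) h assms(2) by (simp add: subspace_add subspace_scale)
    then show ?thesis by simp
  qed
  with g(1) show ?thesis by blast
qed

section \<open>Gradients within a subspace\<close>

text \<open>The whole line through x in direction h stays in V, so a derivative within V becomes a
  two-sided derivative in one real variable.\<close>

lemma has_field_derivative_along_line:
  fixes V :: "'a::real_inner set"
  assumes "subspace V" "x \<in> V" "h \<in> V"
    and "(f has_derivative (\<lambda>k. inner g k)) (at (x + t *\<^sub>R h) within V)"
  shows "((\<lambda>s. f (x + s *\<^sub>R h)) has_real_derivative inner g h) (at t)"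
proof -
  have "((\<lambda>s. x + s *\<^sub>R h) has_derivative (\<lambda>s. s *\<^sub>R h)) (at t)"
    by (auto intro!: derivative_eq_intros)
  moreover have "(\<lambda>s. x + s *\<^sub>R h) ` UNIV \<subseteq> V"
    using assms(1-3) by (auto simp: subspace_add subspace_scale)
  ultimately have "((\<lambda>s. f (x + s *\<^sub>R h)) has_derivative (\<lambda>s. inner g (s *\<^sub>R h))) (at t)"
    using has_derivative_in_compose2[of UNIV f "\<lambda>_ k. inner g k" "\<lambda>s. x + s *\<^sub>R h"]
      has_derivative_in_compose[of "\<lambda>s. x + s *\<^sub>R h" "\<lambda>s. s *\<^sub>R h" t UNIV f "\<lambda>k. inner g k"]
      has_derivative_subset[OF assms(4)] by auto
  then show ?thesis
    by (simp add: has_field_derivative_def mult.commute fun_eq_iff[symmetric] mult_commute_abs)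
qed

text \<open>Two candidates differ by a vector of V, along which both give the derivative of f; hence
  their difference is orthogonal to itself.\<close>

lemma gradient_on_eq:
  fixes V :: "'a::real_inner set"
  assumes "subspace V" "x \<in> V" "g \<in> V" "(f has_derivative (\<lambda>h. inner g h)) (at x within V)"
  shows "gradient_on V f x = g"
  unfolding gradient_on_def
proof (rule the_equality)
  fix g' assume g': "g' \<in> V \<and> (f has_derivative (\<lambda>h. inner g' h)) (at x within V)"
  let ?h = "g' - g"
  have h: "?h \<in> V" using g' assms by (simp add: subspace_diff)
  have "inner g' ?h = inner g ?h"
    using DERIV_unique[OF has_field_derivative_along_line[OF assms(1,2) h, of f g' 0]
        has_field_derivative_along_line[OF assms(1,2) h, of f g 0]] g' assms(4) by simp
  then have "inner ?h ?h = 0" by (simp add: inner_diff_left)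
  then show "g' = g" by simp
qed (use assms in simp)

text \<open>The difference quotient within V evaluates D only at vectors y - x of V, where D agrees
  with its Riesz vector.\<close>

lemma gradient_on_has_derivative:
  fixes V :: "'a::real_inner set"
  assumes V: "complete V" "subspace V" and x: "x \<in> V" and f: "f differentiable (at x within V)"
  shows "gradient_on V f x \<in> V"
    and "(f has_derivative (\<lambda>h. inner (gradient_on V f x) h)) (at x within V)"
proof -
  obtain D where D: "(f has_derivative D) (at x within V)"
    using f unfolding differentiable_def by blast
  obtain g where g: "g \<in> V" "\<And>h. h \<in> V \<Longrightarrow> D h = inner g h"
    using riesz_complete_subspace[OF V has_derivative_bounded_linear[OF D]] by blast
  have "(f has_derivative (\<lambda>h. inner g h)) (at x within V)"
    unfolding has_derivative_within
  proof
    have "((\<lambda>y. (1 / norm (y - x)) *\<^sub>R (f y - (f x + D (y - x)))) \<longlongrightarrow> 0) (at x within V)"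
      using D unfolding has_derivative_within by blast
    then show "((\<lambda>y. (1 / norm (y - x)) *\<^sub>R (f y - (f x + inner g (y - x)))) \<longlongrightarrow> 0) (at x within V)"
      by (rule Lim_transform_eventually)
         (use g x V(2) in \<open>auto simp: eventually_at_filter subspace_diff\<close>)
  qed (rule bounded_linear_inner_right)
  with gradient_on_eq[OF V(2) x g(1)] g(1)
  show "gradient_on V f x \<in> V"
    "(f has_derivative (\<lambda>h. inner (gradient_on V f x) h)) (at x within V)" by auto
qed

text \<open>The remainder is squeezed between 0 and a multiple of |y - x|^2. This is how the
  averaged Moreau envelope gets differentiated.\<close>

lemma has_derivative_of_quadratic_bounds:
  fixes V :: "'a::real_inner set"
  assumes V: "subspace V" "x \<in> V"
    and lower: "\<And>y. y \<in> V \<Longrightarrow> f x + inner g (y - x) \<le> f y"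
    and upper: "\<And>y. y \<in> V \<Longrightarrow> f y \<le> f x + inner g (y - x) + c * (norm (y - x))\<^sup>2"
  shows "(f has_derivative (\<lambda>h. inner g h)) (at x within V)"
  unfolding has_derivative_within
proof
  show "((\<lambda>y. (1 / norm (y - x)) *\<^sub>R (f y - (f x + inner g (y - x)))) \<longlongrightarrow> 0) (at x within V)"
  proof (rule Lim_null_comparison)
    show "\<forall>\<^sub>F y in at x within V.
        norm ((1 / norm (y - x)) *\<^sub>R (f y - (f x + inner g (y - x)))) \<le> c * norm (y - x)"
      unfolding eventually_at_filter
    proof (intro always_eventually allI impI)
      fix y assume y: "y \<noteq> x" "y \<in> V"
      let ?r = "f y - (f x + inner g (y - x))"
      have "0 \<le> ?r" "?r \<le> c * (norm (y - x))\<^sup>2" using lower[OF y(2)] upper[OF y(2)] by simp_all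
      then show "norm ((1 / norm (y - x)) *\<^sub>R ?r) \<le> c * norm (y - x)"
        using y(1) by (simp add: field_simps power2_eq_square)
    qed
    have "((\<lambda>y. c * norm (y - x)) \<longlongrightarrow> c * norm (x - x)) (at x within V)"
      by (intro tendsto_intros)
    then show "((\<lambda>y. c * norm (y - x)) \<longlongrightarrow> 0) (at x within V)" by simp
  qed
qed (rule bounded_linear_inner_right)

lemma convex_on_gradient_lower:
  fixes V :: "'a::real_inner set"
  assumes V: "subspace V" "x \<in> V" "y \<in> V" and f: "convex_on V f"
    and g: "(f has_derivative (\<lambda>h. inner g h)) (at x within V)"
  shows "f x + inner g (y - x) \<le> f y"
proof -
  let ?h = "y - x"
  have h: "?h \<in> V" using V by (simp add: subspace_diff)
  have "convex_on UNIV (\<lambda>s. f (x + s *\<^sub>R ?h))"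
  proof (rule convex_onI)
    fix t a b :: real assume t: "0 < t" "t < 1"
    have "x + ((1 - t) *\<^sub>R a + t *\<^sub>R b) *\<^sub>R ?h
        = (1 - t) *\<^sub>R (x + a *\<^sub>R ?h) + t *\<^sub>R (x + b *\<^sub>R ?h)"
      by (simp add: algebra_simps)
    then show "f (x + ((1 - t) *\<^sub>R a + t *\<^sub>R b) *\<^sub>R ?h)
        \<le> (1 - t) * f (x + a *\<^sub>R ?h) + t * f (x + b *\<^sub>R ?h)"
      using convex_onD[OF f, of t "x + a *\<^sub>R ?h" "x + b *\<^sub>R ?h"] t V h
      by (simp add: subspace_add subspace_scale)
  qed simp
  moreover have "((\<lambda>s. f (x + s *\<^sub>R ?h)) has_real_derivative inner g ?h) (at 0)"
    by (rule has_field_derivative_along_line[OF V(1,2) h]) (simp add: g)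
  ultimately have "f (x + 1 *\<^sub>R ?h) - f (x + 0 *\<^sub>R ?h) \<ge> inner g ?h * (1 - 0)"
    by (intro convex_on_imp_above_tangent[of UNIV]) auto
  then show ?thesis by simp
qed

lemma lipschitz_gradient_upper:
  fixes V :: "'a::real_inner set"
  assumes V: "subspace V" "x \<in> V" "y \<in> V"
    and G: "\<And>z. z \<in> V \<Longrightarrow> (f has_derivative (\<lambda>h. inner (G z) h)) (at z within V)"
    and L: "L-lipschitz_on V G"
  shows "f y \<le> f x + inner (G x) (y - x) + L / 2 * (norm (y - x))\<^sup>2"
proof -
  let ?h = "y - x"
  have h: "?h \<in> V" using V by (simp add: subspace_diff)
  have line: "x + t *\<^sub>R ?h \<in> V" for t using V h by (simp add: subspace_add subspace_scale)
  \<comment> \<open>\<open>\<psi>\<close> compares f along the segment with its quadratic model; its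
    monotonicity gives the descent lemma without integrating the gradient.\<close>
  define \<psi> where "\<psi> t = f (x + t *\<^sub>R ?h) - t * inner (G x) ?h - L / 2 * (t\<^sup>2 * (norm ?h)\<^sup>2)" for t
  have "\<psi> 1 \<le> \<psi> 0"
  proof (rule DERIV_nonpos_imp_nonincreasing[of 0 1 \<psi>])
    fix t :: real assume t: "0 \<le> t" "t \<le> 1"
    have "((\<lambda>s. f (x + s *\<^sub>R ?h)) has_real_derivative inner (G (x + t *\<^sub>R ?h)) ?h) (at t)"
      by (rule has_field_derivative_along_line[OF V(1,2) h G[OF line]])
    then have "(\<psi> has_real_derivative
        (inner (G (x + t *\<^sub>R ?h)) ?h - inner (G x) ?h - L * t * (norm ?h)\<^sup>2)) (at t)"
      unfolding \<psi>_def by (auto intro!: derivative_eq_intros)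
    moreover have "inner (G (x + t *\<^sub>R ?h)) ?h - inner (G x) ?h - L * t * (norm ?h)\<^sup>2 \<le> 0"
    proof -
      have "inner (G (x + t *\<^sub>R ?h) - G x) ?h \<le> norm (G (x + t *\<^sub>R ?h) - G x) * norm ?h"
        by (rule norm_cauchy_schwarz)
      also have "norm (G (x + t *\<^sub>R ?h) - G x) \<le> L * (t * norm ?h)"
        using lipschitz_onD[OF L line[of t] V(2)] t by (simp add: dist_norm)
      finally show ?thesis
        by (simp add: inner_diff_left power2_eq_square mult_right_mono algebra_simps)
    qed
    ultimately show "\<exists>y. (\<psi> has_real_derivative y) (at t) \<and> y \<le> 0" by blast
  qed simp
  then show ?thesis by (simp add: \<psi>_def)
qed

text \<open>The tangent bound at x and the descent lemma at y are compared at a common point z,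
  whose choice produces the quadratic term.\<close>

lemma convex_smooth_lower:
  fixes V :: "'a::real_inner set"
  assumes V: "subspace V" "x \<in> V" "y \<in> V"
    and lower: "\<And>z. z \<in> V \<Longrightarrow> f x + inner (G x) (z - x) \<le> f z"
    and GV: "\<And>z. z \<in> V \<Longrightarrow> G z \<in> V"
    and G: "\<And>z. z \<in> V \<Longrightarrow> (f has_derivative (\<lambda>h. inner (G z) h)) (at z within V)"
    and L: "L-lipschitz_on V G" and "L > 0"
  shows "f x + inner (G x) (y - x) + 1 / (2 * L) * (norm (G x - G y))\<^sup>2 \<le> f y"
proof -
  define w where "w = G x - G y"
  \<comment> \<open>This z minimizes the quadratic upper model of f at y after subtracting the
    linear function with gradient \<open>G x\<close>.\<close>
  define z where "z = y + (1 / L) *\<^sub>R w"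
  have "z \<in> V" unfolding z_def w_def
    using V GV by (simp add: subspace_add subspace_diff subspace_scale)
  have "f z \<le> f y + inner (G y) (z - y) + L / 2 * (norm (z - y))\<^sup>2"
    by (rule lipschitz_gradient_upper[OF V(1,3) \<open>z \<in> V\<close> G L])
  moreover have "f x + inner (G x) (z - x) \<le> f z" by (rule lower[OF \<open>z \<in> V\<close>])
  moreover have "inner (G x) (z - x) - inner (G y) (z - y)
      = inner (G x) (y - x) + 1 / L * (norm w)\<^sup>2"
    unfolding power2_norm_eq_inner
    by (simp add: z_def w_def inner_diff_left inner_diff_right inner_add_right inner_commute
        algebra_simps)
  moreover have "L / 2 * (norm (z - y))\<^sup>2 = 1 / (2 * L) * (norm w)\<^sup>2"
    using \<open>L > 0\<close> by (simp add: z_def power_mult_distrib power2_eq_square field_simps)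
  moreover have "1 / L * (norm w)\<^sup>2 = 2 * (1 / (2 * L) * (norm w)\<^sup>2)" by simp
  ultimately show ?thesis unfolding w_def[symmetric] by linarith
qed

text \<open>Not divided by L, so that L = 0 is covered.\<close>

lemma critical_cocoercive:
  fixes V :: "'a::real_inner set"
  assumes V: "subspace V" "x \<in> V" "p \<in> V" and p: "G p = 0"
    and lower: "\<And>z w. z \<in> V \<Longrightarrow> w \<in> V \<Longrightarrow> f w + inner (G w) (z - w) \<le> f z"
    and GV: "\<And>z. z \<in> V \<Longrightarrow> G z \<in> V"
    and G: "\<And>z. z \<in> V \<Longrightarrow> (f has_derivative (\<lambda>h. inner (G z) h)) (at z within V)"
    and L: "L-lipschitz_on V G"
  shows "(norm (G x))\<^sup>2 \<le> L * inner (G x) (x - p)"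
proof (cases "L = 0")
  case True
  then have "G x = 0" using lipschitz_onD[OF L V(2,3)] p by simp
  then show ?thesis by simp
next
  case False
  then have "L > 0" using lipschitz_on_nonneg[OF L] by simp
  \<comment> \<open>The bounds for (x, p) and (p, x) are added: the function values cancel, and
    \<open>G p = 0\<close> leaves twice the quadratic term.\<close>
  from convex_smooth_lower[OF V(1,2,3) lower[OF _ V(2)] GV G L this]
    convex_smooth_lower[OF V(1,3,2) lower[OF _ V(3)] GV G L this]
  have "1 / (2 * L) * (norm (G x))\<^sup>2 + 1 / (2 * L) * (norm (G x))\<^sup>2 \<le> inner (G x) (x - p)"
    by (simp add: p inner_diff_right)
  then show ?thesis using \<open>L > 0\<close> by (simp add: field_simps)
qed

lemma average_mono:
  assumes "\<And>i. i \<in> {1..n} \<Longrightarrow> a i \<le> b i"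
  shows "(1 / real n) * (\<Sum>i\<in>{1..n}. a i) \<le> (1 / real n) * (\<Sum>i\<in>{1..n}. b i)"
  by (intro mult_left_mono sum_mono assms) auto

section \<open>Proximal points and Moreau envelopes\<close>

text \<open>The quadratic term makes the objective strongly convex with midpoint constant 1 / (8
  \<gamma>). Once a minimizer is known to exist, the choice made by \<open>prox\<close> is
  one.\<close>

lemma prox_minimizer:
  fixes V :: "'a::real_inner set"
  assumes V: "complete V" "subspace V" and x: "x \<in> V" and f: "convex_on V f" and "\<gamma> > 0"
    and G: "\<And>z. z \<in> V \<Longrightarrow> (f has_derivative (\<lambda>h. inner (G z) h)) (at z within V)"
    and b: "\<And>z. z \<in> V \<Longrightarrow> b \<le> f z"
  shows "prox V \<gamma> f x \<in> V"
    and "z \<in> V \<Longrightarrow> f (prox V \<gamma> f x) + 1 / (2 * \<gamma>) * (norm (prox V \<gamma> f x - x))\<^sup>2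
      \<le> f z + 1 / (2 * \<gamma>) * (norm (z - x))\<^sup>2"
proof -
  define \<phi> where "\<phi> z = f z + 1 / (2 * \<gamma>) * (norm (z - x))\<^sup>2" for z
  have "\<exists>p\<in>V. \<forall>y\<in>V. \<phi> p \<le> \<phi> y"
  proof (rule strongly_convex_attains_min[OF V(1), where c = "1 / (8 * \<gamma>)"])
    show "V \<noteq> {}" using x by blast
    have "continuous_on V f"
      using G has_derivative_continuous continuous_on_eq_continuous_within by blast
    then show "continuous_on V \<phi>" unfolding \<phi>_def by (intro continuous_intros)
    have "b \<le> \<phi> z" if "z \<in> V" for z
      using b[OF that] \<open>\<gamma> > 0\<close> unfolding \<phi>_def by (simp add: add_increasing2)
    then show "bdd_below (\<phi> ` V)" by (rule bdd_belowI2)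
    show "(1/2) *\<^sub>R (y + z) \<in> V" if "y \<in> V" "z \<in> V" for y z
      using that V(2) by (simp add: subspace_add subspace_scale)
    show "\<phi> ((1/2) *\<^sub>R (y + z)) \<le> (\<phi> y + \<phi> z) / 2 - 1 / (8 * \<gamma>) * (norm (y - z))\<^sup>2"
      if "y \<in> V" "z \<in> V" for y z
    proof -
      have "f ((1/2) *\<^sub>R (y + z)) \<le> (f y + f z) / 2"
        using convex_onD[OF f, of "1/2" y z] that by (simp add: scaleR_add_right)
      then show ?thesis
        unfolding \<phi>_def norm_midpoint_sq by (simp add: algebra_simps add_divide_distrib diff_divide_distrib)
    qed
  qed (use \<open>\<gamma> > 0\<close> in simp)
  then obtain p where p: "is_arg_min \<phi> (\<lambda>z. z \<in> V) p"
    unfolding is_arg_min_linorder by blast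
  have "is_arg_min \<phi> (\<lambda>z. z \<in> V) (prox V \<gamma> f x)"
    unfolding prox_def arg_min_def \<phi>_def[symmetric] using p by (rule someI)
  then show "prox V \<gamma> f x \<in> V"
    and "z \<in> V \<Longrightarrow> f (prox V \<gamma> f x) + 1 / (2 * \<gamma>) * (norm (prox V \<gamma> f x - x))\<^sup>2
      \<le> f z + 1 / (2 * \<gamma>) * (norm (z - x))\<^sup>2"
    by (auto simp: is_arg_min_linorder \<phi>_def)
qed

lemma moreau_eq_prox:
  assumes "prox V \<gamma> f x \<in> V"
    and "\<And>z. z \<in> V \<Longrightarrow> f (prox V \<gamma> f x) + 1 / (2 * \<gamma>) * (norm (prox V \<gamma> f x - x))\<^sup>2
      \<le> f z + 1 / (2 * \<gamma>) * (norm (z - x))\<^sup>2"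
  shows "moreau V \<gamma> f x = f (prox V \<gamma> f x) + 1 / (2 * \<gamma>) * (norm (prox V \<gamma> f x - x))\<^sup>2"
  unfolding moreau_def by (rule cInf_eq_minimum) (use assms in auto)

lemma gradient_at_prox:
  fixes V :: "'a::real_inner set"
  assumes V: "subspace V" "x \<in> V" "p \<in> V" and "\<gamma> > 0" and g: "g \<in> V" "(f has_derivative (\<lambda>h. inner g h)) (at p within V)"
    and min: "\<And>z. z \<in> V \<Longrightarrow> f p + 1 / (2 * \<gamma>) * (norm (p - x))\<^sup>2
      \<le> f z + 1 / (2 * \<gamma>) * (norm (z - x))\<^sup>2"
  shows "g = (1 / \<gamma>) *\<^sub>R (x - p)"
proof -
  \<comment> \<open>The residual of the optimality condition is itself the test direction; the
    derivative of the objective along it is |h|^2.\<close>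
  define h where "h = g - (1 / \<gamma>) *\<^sub>R (x - p)"
  have h: "h \<in> V" unfolding h_def using V g(1) by (simp add: subspace_diff subspace_scale)
  have "((\<lambda>t. f (p + t *\<^sub>R h)) has_real_derivative inner g h) (at 0)"
    by (rule has_field_derivative_along_line[OF V(1,3) h]) (simp add: g)
  moreover have "((\<lambda>t. 1 / (2 * \<gamma>) * ((norm (p - x))\<^sup>2 + 2 * t * inner (p - x) h + t\<^sup>2 * (norm h)\<^sup>2))
      has_real_derivative 1 / (2 * \<gamma>) * (2 * inner (p - x) h)) (at 0)"
    using \<open>\<gamma> > 0\<close> by (auto intro!: derivative_eq_intros)
  moreover have "(norm (p + t *\<^sub>R h - x))\<^sup>2 = (norm (p - x))\<^sup>2 + 2 * t * inner (p - x) h + t\<^sup>2 * (norm h)\<^sup>2"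
    for t
    unfolding power2_norm_eq_inner
    by (simp add: inner_diff_left inner_diff_right inner_add_left inner_add_right inner_commute
        algebra_simps power2_eq_square)
  ultimately have d: "((\<lambda>t. f (p + t *\<^sub>R h) + 1 / (2 * \<gamma>) * (norm (p + t *\<^sub>R h - x))\<^sup>2)
      has_real_derivative inner g h + 1 / (2 * \<gamma>) * (2 * inner (p - x) h)) (at 0)"
    using DERIV_add by simp
  have "inner g h + 1 / (2 * \<gamma>) * (2 * inner (p - x) h) = 0"
    by (rule DERIV_local_min[OF d zero_less_one])
       (use min[of "p + _ *\<^sub>R h"] V h in \<open>simp add: subspace_add subspace_scale\<close>)
  then have "inner g h = (1 / \<gamma>) * (inner x h - inner p h)"
    using \<open>\<gamma> > 0\<close> by (simp add: inner_diff_left field_simps)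
  then have "inner h h = 0"
    unfolding h_def[THEN arg_cong[where f = "\<lambda>v. inner v h"]]
    by (simp add: inner_diff_left)
  then show ?thesis by (simp add: h_def)
qed

text \<open>Here p and q are the proximal points of x and y, and fp and fq the values of f there; then
  (x - p) / \<gamma> is the gradient of f at p, and the assumption of the lower bound is convexity of f.\<close>

lemma moreau_lower_bound:
  fixes x y p q :: "'a::real_inner"
  assumes "\<gamma> > 0" and "fp + inner ((1 / \<gamma>) *\<^sub>R (x - p)) (q - p) \<le> fq"
  shows "fp + 1 / (2 * \<gamma>) * (norm (p - x))\<^sup>2 + inner ((1 / \<gamma>) *\<^sub>R (x - p)) (y - x)
    \<le> fq + 1 / (2 * \<gamma>) * (norm (q - y))\<^sup>2"
proof -
  \<comment> \<open>The slack left after using convexity of f is exactly this square.\<close>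
  have "0 \<le> 1 / (2 * \<gamma>) * (norm ((x - p) - (y - q)))\<^sup>2" using \<open>\<gamma> > 0\<close> by simp
  also have "\<dots> = 1 / (2 * \<gamma>) * (norm (q - y))\<^sup>2 - 1 / (2 * \<gamma>) * (norm (p - x))\<^sup>2
      - inner ((1 / \<gamma>) *\<^sub>R (x - p)) (y - x) + inner ((1 / \<gamma>) *\<^sub>R (x - p)) (q - p)"
    using \<open>\<gamma> > 0\<close> unfolding power2_norm_eq_inner
    by (simp add: inner_diff_left inner_diff_right inner_add_left inner_add_right inner_commute field_simps)
  finally show ?thesis using assms(2) by linarith
qed

text \<open>With p the proximal point of x, the hypothesis says that p competes in the minimization
  defining the envelope at y; expanding the square around x gives the rest.\<close>

lemma moreau_upper_bound:
  fixes x y p :: "'a::real_inner"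
  assumes "\<gamma> > 0" and "My \<le> fp + 1 / (2 * \<gamma>) * (norm (p - y))\<^sup>2"
  shows "My \<le> fp + 1 / (2 * \<gamma>) * (norm (p - x))\<^sup>2 + inner ((1 / \<gamma>) *\<^sub>R (x - p)) (y - x)
    + 1 / (2 * \<gamma>) * (norm (y - x))\<^sup>2"
proof -
  have "1 / (2 * \<gamma>) * (norm (p - y))\<^sup>2 = 1 / (2 * \<gamma>) * (norm (p - x))\<^sup>2
      + inner ((1 / \<gamma>) *\<^sub>R (x - p)) (y - x) + 1 / (2 * \<gamma>) * (norm (y - x))\<^sup>2"
    using \<open>\<gamma> > 0\<close> unfolding power2_norm_eq_inner
    by (simp add: inner_diff_left inner_diff_right inner_add_left inner_add_right inner_commute field_simps)
  then show ?thesis using assms(2) by linarith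
qed

section \<open>Moments of nice sampling\<close>

text \<open>Removing B is a bijection onto the subsets of A - B of size k - card B. With B of one or
  two elements this gives the inclusion probabilities of nice sampling.\<close>

lemma card_subsets_containing:
  assumes "finite A" "B \<subseteq> A" "card B \<le> k"
  shows "card {T. T \<subseteq> A \<and> card T = k \<and> B \<subseteq> T} = (card A - card B) choose (k - card B)"
proof -
  have fB: "finite B" using assms finite_subset by blast
  have "bij_betw (\<lambda>T. T - B) {T. T \<subseteq> A \<and> card T = k \<and> B \<subseteq> T}
      {T. T \<subseteq> A - B \<and> card T = k - card B}"
  proof (rule bij_betw_byWitness[where f' = "\<lambda>T. T \<union> B"])
    show "(\<lambda>T. T - B) ` {T. T \<subseteq> A \<and> card T = k \<and> B \<subseteq> T} \<subseteq> {T. T \<subseteq> A - B \<and> card T = k - card B}"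
      using fB by (auto simp: card_Diff_subset)
    show "(\<lambda>T. T \<union> B) ` {T. T \<subseteq> A - B \<and> card T = k - card B} \<subseteq> {T. T \<subseteq> A \<and> card T = k \<and> B \<subseteq> T}"
    proof clarify
      fix T assume T: "T \<subseteq> A - B" "card T = k - card B"
      then have "card (T \<union> B) = card T + card B"
        using assms fB by (intro card_Un_disjoint) (auto intro: finite_subset)
      then show "T \<union> B \<subseteq> A \<and> card (T \<union> B) = k \<and> B \<subseteq> T \<union> B"
        using T assms by auto
    qed
  qed auto
  from bij_betw_same_card[OF this] show ?thesis
    using n_subsets[of "A - B" "k - card B"] assms fB by (simp add: card_Diff_subset)
qed

lemma finite_nice_family: "finite {T. T \<subseteq> {1..n::nat} \<and> card T = S}"
  by (rule finite_subset[of _ "Pow {1..n}"]) auto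

lemma nice_family_nonempty:
  assumes "S \<le> n" shows "{T. T \<subseteq> {1..n::nat} \<and> card T = S} \<noteq> {}"
  using assms by (auto intro!: exI[of _ "{1..S}"])

lemma set_nice_sampling:
  assumes "S \<le> n" shows "set_pmf (nice_sampling n S) = {T. T \<subseteq> {1..n} \<and> card T = S}"
  unfolding nice_sampling_def using finite_nice_family nice_family_nonempty[OF assms] by simp

lemma expectation_nice_sampling:
  fixes h :: "nat set \<Rightarrow> real"
  assumes "S \<le> n"
  shows "measure_pmf.expectation (nice_sampling n S) h
    = (\<Sum>T | T \<subseteq> {1..n} \<and> card T = S. h T) / real (n choose S)"
  unfolding nice_sampling_def
  using integral_pmf_of_set[OF nice_family_nonempty[OF assms] finite_nice_family, of h]
  by (simp add: n_subsets)

text \<open>After swapping the sums, each index is counted with its inclusion probability S / n, by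
  the absorption identity for binomials.\<close>

lemma nice_sampling_expectation_sum:
  fixes a :: "nat \<Rightarrow> real"
  assumes "1 \<le> S" "S \<le> n"
  shows "measure_pmf.expectation (nice_sampling n S) (\<lambda>T. \<Sum>i\<in>T. a i)
    = real S / real n * (\<Sum>i\<in>{1..n}. a i)"
proof -
  let ?F = "{T. T \<subseteq> {1..n} \<and> card T = S}"
  have "(\<Sum>T\<in>?F. \<Sum>i\<in>T. a i) = (\<Sum>T\<in>?F. \<Sum>i\<in>{1..n}. if i \<in> T then a i else 0)"
    by (intro sum.cong refl sum.mono_neutral_cong_left) auto
  also have "\<dots> = (\<Sum>i\<in>{1..n}. \<Sum>T\<in>?F. if i \<in> T then a i else 0)" by (rule sum.swap)
  also have "\<dots> = (\<Sum>i\<in>{1..n}. real ((n - 1) choose (S - 1)) * a i)"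
  proof (intro sum.cong refl)
    fix i assume i: "i \<in> {1..n}"
    have "(\<Sum>T\<in>?F. if i \<in> T then a i else 0)
        = real (card {T. T \<subseteq> {1..n} \<and> card T = S \<and> {i} \<subseteq> T}) * a i"
      using finite_nice_family[of n S]
      by (simp add: sum.If_cases Int_def conj_assoc)
    then show "(\<Sum>T\<in>?F. if i \<in> T then a i else 0) = real ((n - 1) choose (S - 1)) * a i"
      using card_subsets_containing[of "{1..n}" "{i}" S] i assms by simp
  qed
  finally have "(\<Sum>T\<in>?F. \<Sum>i\<in>T. a i) = real ((n - 1) choose (S - 1)) * (\<Sum>i\<in>{1..n}. a i)"
    by (simp add: sum_distrib_left)
  moreover have "real S * real (n choose S) = real n * real ((n - 1) choose (S - 1))"
    using times_binomial_minus1_eq[of S n] assms by (metis of_nat_mult less_eq_Suc_le One_nat_def)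
  moreover have "n choose S > 0" using assms by simp
  ultimately show ?thesis
    unfolding expectation_nice_sampling[OF assms(2)] using assms by (simp add: field_simps)
qed

text \<open>\<open>c1\<close> and \<open>c2\<close> are the inclusion probabilities of one index and
  of two distinct indices. Writing the diagonal weight as \<open>c2 + (c1 - c2)\<close> splits off
  the full double sum, matching the two terms of \<open>nice_smoothness\<close>.\<close>

lemma nice_sampling_expectation_double_sum:
  fixes a :: "nat \<Rightarrow> nat \<Rightarrow> real"
  assumes "1 \<le> S" "S \<le> n" "2 \<le> n"
  shows "measure_pmf.expectation (nice_sampling n S) (\<lambda>T. \<Sum>i\<in>T. \<Sum>j\<in>T. a i j)
    = real S * (real n - real S) / (real n * (real n - 1)) * (\<Sum>i\<in>{1..n}. a i i)
      + real S * (real S - 1) / (real n * (real n - 1)) * (\<Sum>i\<in>{1..n}. \<Sum>j\<in>{1..n}. a i j)"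
proof -
  let ?F = "{T. T \<subseteq> {1..n} \<and> card T = S}"
  define c1 where "c1 = real S / real n"
  define c2 where "c2 = real S * (real S - 1) / (real n * (real n - 1))"
  define w where "w i j = (if i = j then c1 else c2)" for i j :: nat
  have N: "real (n choose S) > 0" using assms by simp
  have one: "real S * real (n choose S) = real n * real ((n - 1) choose (S - 1))"
    using times_binomial_minus1_eq[of S n] assms by (metis of_nat_mult less_eq_Suc_le One_nat_def)
  have cnt: "(\<Sum>T\<in>?F. if i \<in> T \<and> j \<in> T then a i j else 0) = real (n choose S) * (w i j * a i j)"
    if ij: "i \<in> {1..n}" "j \<in> {1..n}" for i j
  proof -
    have "(\<Sum>T\<in>?F. if i \<in> T \<and> j \<in> T then a i j else 0)
        = real (card {T. T \<subseteq> {1..n} \<and> card T = S \<and> {i, j} \<subseteq> T}) * a i j"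
      using finite_nice_family[of n S] by (simp add: sum.If_cases Int_def conj_assoc)
    also have "real (card {T. T \<subseteq> {1..n} \<and> card T = S \<and> {i, j} \<subseteq> T}) = real (n choose S) * w i j"
    proof (cases "i = j")
      case True
      then show ?thesis
        using card_subsets_containing[of "{1..n}" "{i}" S] ij assms one
        by (simp add: w_def c1_def field_simps)
    next
      case neq: False
      \<comment> \<open>For S = 1 no sample contains two indices and \<open>c2\<close> is 0; the
        count by binomials needs S at least 2.\<close>
      show ?thesis
      proof (cases "S = 1")
        case True
        have "{T. T \<subseteq> {1..n} \<and> card T = S \<and> {i, j} \<subseteq> T} = {}"
          using True neq by (auto simp: card_1_singleton_iff)
        then show ?thesis using True neq by (simp add: w_def c2_def)
      next
        case False
        then have S: "S \<ge> 2" using assms by simp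
        have "card {T. T \<subseteq> {1..n} \<and> card T = S \<and> {i, j} \<subseteq> T} = (n - 2) choose (S - 2)"
          using card_subsets_containing[of "{1..n}" "{i, j}" S] ij neq S by (simp add: numeral_2_eq_2)
        moreover have "(S - 1) * ((n - 1) choose (S - 1)) = (n - 1) * ((n - 2) choose (S - 2))"
          using times_binomial_minus1_eq[of "S - 1" "n - 1"] S by (simp add: numeral_2_eq_2)
        then have "real (S - 1) * real ((n - 1) choose (S - 1))
            = real (n - 1) * real ((n - 2) choose (S - 2))"
          by (metis of_nat_mult)
        then have "(real S - 1) * real ((n - 1) choose (S - 1))
            = (real n - 1) * real ((n - 2) choose (S - 2))"
          using assms by (simp add: of_nat_diff)
        then have "real ((n - 2) choose (S - 2)) = (real S - 1) * real ((n - 1) choose (S - 1)) / (real n - 1)"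
          using assms by (simp add: field_simps)
        moreover have "real ((n - 1) choose (S - 1)) = real S * real (n choose S) / real n"
          using one assms by (simp add: field_simps)
        ultimately show ?thesis
          using neq by (simp add: w_def c2_def)
      qed
    qed
    finally show ?thesis by (simp add: mult.assoc)
  qed
  have "(\<Sum>T\<in>?F. \<Sum>i\<in>T. \<Sum>j\<in>T. a i j)
      = (\<Sum>T\<in>?F. \<Sum>i\<in>{1..n}. \<Sum>j\<in>{1..n}. if i \<in> T \<and> j \<in> T then a i j else 0)"
    by (intro sum.cong refl sum.mono_neutral_cong_left) (auto intro!: sum.mono_neutral_cong_left)
  also have "\<dots> = (\<Sum>i\<in>{1..n}. \<Sum>j\<in>{1..n}. \<Sum>T\<in>?F. if i \<in> T \<and> j \<in> T then a i j else 0)"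
    by (subst sum.swap) (intro sum.cong refl sum.swap)
  also have "\<dots> = real (n choose S) * (\<Sum>i\<in>{1..n}. \<Sum>j\<in>{1..n}. w i j * a i j)"
    unfolding sum_distrib_left by (intro sum.cong refl cnt)
  also have "(\<Sum>i\<in>{1..n}. \<Sum>j\<in>{1..n}. w i j * a i j)
      = (\<Sum>i\<in>{1..n}. (c1 - c2) * a i i + c2 * (\<Sum>j\<in>{1..n}. a i j))"
  proof (intro sum.cong refl)
    fix i assume i: "i \<in> {1..n}"
    have "(\<Sum>j\<in>{1..n}. w i j * a i j)
        = (\<Sum>j\<in>{1..n}. (if i = j then (c1 - c2) * a i j else 0) + c2 * a i j)"
      by (intro sum.cong refl) (simp add: w_def algebra_simps)
    also have "\<dots> = (c1 - c2) * a i i + c2 * (\<Sum>j\<in>{1..n}. a i j)"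
      using i by (simp add: sum.distrib sum_distrib_left)
    finally show "(\<Sum>j\<in>{1..n}. w i j * a i j) = (c1 - c2) * a i i + c2 * (\<Sum>j\<in>{1..n}. a i j)" .
  qed
  also have "\<dots> = (c1 - c2) * (\<Sum>i\<in>{1..n}. a i i) + c2 * (\<Sum>i\<in>{1..n}. \<Sum>j\<in>{1..n}. a i j)"
    by (simp add: sum.distrib sum_distrib_left)
  also have "c1 - c2 = real S * (real n - real S) / (real n * (real n - 1))"
    using assms by (simp add: c1_def c2_def field_simps)
  finally show ?thesis
    unfolding expectation_nice_sampling[OF assms(2)] using N by (simp add: c2_def)
qed

section \<open>Quadratic growth from the Polyak-Lojasiewicz condition\<close>

text \<open>With \<open>a k\<close> the square root of the gap, each step has length at most
  \<open>c * (a k - a (Suc k))\<close>. Telescoping bounds the length of the path by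
  \<open>c * a 0\<close>, so the iterates converge, and squaring turns this into quadratic
  growth.\<close>

lemma gradient_descent_pl:
  fixes V :: "'a::real_inner set"
  assumes V: "complete V" "subspace V" and x: "x \<in> V"
    and GV: "\<And>z. z \<in> V \<Longrightarrow> G z \<in> V"
    and G: "\<And>z. z \<in> V \<Longrightarrow> (f has_derivative (\<lambda>h. inner (G z) h)) (at z within V)"
    and L: "L-lipschitz_on V G" "L > 0"
    and min: "\<And>z. z \<in> V \<Longrightarrow> m \<le> f z"
    and "\<mu> > 0" and pl: "\<And>z. z \<in> V \<Longrightarrow> \<mu> * (f z - m) \<le> 1 / 2 * (norm (G z))\<^sup>2"
  shows "\<exists>y\<in>V. G y = 0 \<and> \<mu> / 8 * (norm (x - y))\<^sup>2 \<le> f x - m"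
proof -
  define Y where "Y = rec_nat x (\<lambda>_ y. y - (1 / L) *\<^sub>R G y)"
  have Y0: "Y 0 = x" and YS: "Y (Suc k) = Y k - (1 / L) *\<^sub>R G (Y k)" for k
    by (simp_all add: Y_def)
  have YV: "Y k \<in> V" for k
    by (induction k) (use x GV V(2) in \<open>simp_all add: Y0 YS subspace_diff subspace_scale\<close>)
  define a where "a k = sqrt (f (Y k) - m)" for k
  \<comment> \<open>Descent gives s^2 \<le> 4 L (\<open>a k - a (Suc k)\<close>) \<open>a k\<close>
    for the gradient norm s, and the Polyak-Lojasiewicz condition gives s \<ge>
    \<open>sqrt (2 * \<mu>) * a k\<close>; dividing yields this constant for the step length s /
    L.\<close>
  define c where "c = 4 / sqrt (2 * \<mu>)"
  have "c > 0" and c2: "c\<^sup>2 = 8 / \<mu>"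
    using \<open>\<mu> > 0\<close> by (simp_all add: c_def power_divide)
  have a0: "a k \<ge> 0" and a2: "(a k)\<^sup>2 = f (Y k) - m" for k
    using min[OF YV] by (simp_all add: a_def)
  have step: "norm (Y (Suc k) - Y k) \<le> c * (a k - a (Suc k))" for k
  proof -
    define s where "s = norm (G (Y k))"
    have n: "norm (Y (Suc k) - Y k) = s / L" using L(2) by (simp add: YS s_def)
    have "f (Y (Suc k)) \<le> f (Y k) + inner (G (Y k)) (Y (Suc k) - Y k)
        + L / 2 * (norm (Y (Suc k) - Y k))\<^sup>2"
      by (rule lipschitz_gradient_upper[OF V(2) YV YV G L(1)])
    also have "inner (G (Y k)) (Y (Suc k) - Y k) = - (s\<^sup>2 / L)"
      by (simp add: YS s_def power2_norm_eq_inner)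
    also have "L / 2 * (norm (Y (Suc k) - Y k))\<^sup>2 = s\<^sup>2 / L / 2"
      using L(2) by (simp add: n power_divide power2_eq_square)
    finally have dec: "s\<^sup>2 / (2 * L) \<le> (a k)\<^sup>2 - (a (Suc k))\<^sup>2"
      by (simp add: a2 field_simps)
    then have "(a (Suc k))\<^sup>2 \<le> (a k)\<^sup>2" using L(2) by (smt (verit) divide_nonneg_pos zero_le_power2)
    then have mono: "a (Suc k) \<le> a k" using a0 by (simp add: power2_le_iff_abs_le)
    have "s \<ge> 0" by (simp add: s_def)
    have "sqrt (2 * \<mu>) * a k \<le> s"
    proof (rule power2_le_imp_le)
      show "(sqrt (2 * \<mu>) * a k)\<^sup>2 \<le> s\<^sup>2"
        using pl[OF YV[of k]] \<open>\<mu> > 0\<close> by (simp add: power_mult_distrib a2 s_def)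
    qed (rule \<open>s \<ge> 0\<close>)
    \<comment> \<open>The factor \<open>a k\<close> is cancelled in the main case. If it is 0, the
      gradient vanishes and the iteration stands still.\<close>
    show ?thesis
    proof (cases "a k = 0")
      case True
      then have "s\<^sup>2 / (2 * L) \<le> 0" using dec by (smt (verit) zero_le_power2 zero_power2)
      then have "s = 0" using L(2) by (simp add: divide_le_0_iff)
      then show ?thesis using n mono \<open>c > 0\<close> by simp
    next
      case False
      then have "a k > 0" using a0[of k] by simp
      have "(a k)\<^sup>2 - (a (Suc k))\<^sup>2 = (a k - a (Suc k)) * (a k + a (Suc k))"
        by (simp add: power2_eq_square algebra_simps)
      also have "\<dots> \<le> (a k - a (Suc k)) * (2 * a k)"
        using mono by (intro mult_left_mono) auto
      finally have "s\<^sup>2 / (2 * L) \<le> (a k - a (Suc k)) * (2 * a k)"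
        using dec by linarith
      then have "s * s \<le> 4 * L * (a k - a (Suc k)) * a k"
        using L(2) by (simp add: field_simps power2_eq_square)
      moreover have "s * (sqrt (2 * \<mu>) * a k) \<le> s * s"
        using \<open>sqrt (2 * \<mu>) * a k \<le> s\<close> \<open>s \<ge> 0\<close> by (rule mult_left_mono)
      ultimately have "(s * sqrt (2 * \<mu>)) * a k \<le> (4 * L * (a k - a (Suc k))) * a k"
        by (simp add: mult.assoc)
      then have "s * sqrt (2 * \<mu>) \<le> 4 * L * (a k - a (Suc k))"
        using \<open>a k > 0\<close> by simp
      then show ?thesis unfolding n c_def using L(2) \<open>\<mu> > 0\<close> by (simp add: field_simps)
    qed
  qed
  have path: "norm (Y (j + k) - Y j) \<le> c * (a j - a (j + k))" for j k
  proof (induction k)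
    case (Suc k)
    have "norm (Y (j + Suc k) - Y j) \<le> norm (Y (Suc (j + k)) - Y (j + k)) + norm (Y (j + k) - Y j)"
      using norm_triangle_ineq[of "Y (Suc (j + k)) - Y (j + k)" "Y (j + k) - Y j"] by simp
    also have "\<dots> \<le> c * (a j - a (j + Suc k))"
      using step[of "j + k"] Suc.IH by (simp add: algebra_simps)
    finally show ?case .
  qed simp
  have "decseq a"
  proof (rule decseq_SucI)
    fix k
    have "0 \<le> c * (a k - a (Suc k))" using step[of k] norm_ge_zero order_trans by blast
    then show "a (Suc k) \<le> a k" using \<open>c > 0\<close> by (simp add: zero_le_mult_iff)
  qed
  then obtain l where l: "a \<longlonglongrightarrow> l" "\<And>k. l \<le> a k"
    using decseq_convergent[of a 0] a0 by metis
  have "Cauchy Y"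
  proof (rule CauchyI)
    fix e :: real assume "e > 0"
    then have "e / (2 * c) > 0" using \<open>c > 0\<close> by simp
    then obtain N where N: "\<And>k. k \<ge> N \<Longrightarrow> \<bar>a k - l\<bar> < e / (2 * c)"
      using LIMSEQ_D[OF l(1)] by auto
    have b: "norm (Y k - Y N) < e / 2" if "k \<ge> N" for k
    proof -
      have "norm (Y k - Y N) \<le> c * (a N - a k)" using path[of N "k - N"] that by simp
      also have "\<dots> \<le> c * (a N - l)" using l(2)[of k] \<open>c > 0\<close> by simp
      also have "\<dots> < e / 2"
        using N[of N] \<open>c > 0\<close> by (simp add: field_simps abs_less_iff)
      finally show ?thesis .
    qed
    have "norm (Y j - Y k) < e" if "j \<ge> N" "k \<ge> N" for j k
      using norm_diff_triangle_less[of "Y j" "Y N" "e / 2" "Y k" "e / 2"] b[OF that(1)] b[OF that(2)]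
      by (simp add: norm_minus_commute)
    then show "\<exists>N. \<forall>j\<ge>N. \<forall>k\<ge>N. norm (Y j - Y k) < e" by blast
  qed
  then obtain y where y: "y \<in> V" "Y \<longlonglongrightarrow> y"
    using V(1) YV unfolding complete_def by blast
  \<comment> \<open>The gradients are L times the consecutive differences of a convergent sequence,
    so they tend to 0, and also to \<open>G y\<close> by continuity.\<close>
  have "(\<lambda>k. G (Y k)) \<longlonglongrightarrow> G y"
    using continuous_on_tendsto_compose[OF lipschitz_on_continuous_on[OF L(1)] y(2,1)] YV by simp
  moreover have "(\<lambda>k. L *\<^sub>R (Y k - Y (Suc k))) \<longlonglongrightarrow> L *\<^sub>R (y - y)"
    by (intro tendsto_intros y(2) LIMSEQ_Suc)
  moreover have "L *\<^sub>R (Y k - Y (Suc k)) = G (Y k)" for k using L(2) by (simp add: YS)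
  ultimately have "G y = 0" using LIMSEQ_unique by fastforce
  have "(\<lambda>k. norm (x - Y k)) \<longlonglongrightarrow> norm (x - y)" by (intro tendsto_intros y(2))
  then have "norm (x - y) \<le> c * a 0"
  proof (rule LIMSEQ_le_const2)
    have "c * (a 0 - a k) \<le> c * a 0" for k using a0[of k] \<open>c > 0\<close> by simp
    then show "\<exists>N. \<forall>k\<ge>N. norm (x - Y k) \<le> c * a 0"
      using path[of 0] by (metis Y0 add_0 norm_minus_commute order_trans)
  qed
  then have "(norm (x - y))\<^sup>2 \<le> (c * a 0)\<^sup>2" by (rule power_mono) simp
  then have "\<mu> / 8 * (norm (x - y))\<^sup>2 \<le> f x - m"
    using \<open>\<mu> > 0\<close> by (simp add: power_mult_distrib c2 a2 Y0 field_simps)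
  with y(1) \<open>G y = 0\<close> show ?thesis by blast
qed

section \<open>Sublevel sets, projections and averages\<close>

lemma convex_sublevel:
  assumes "convex_on S f"
  shows "convex {x \<in> S. f x \<le> c}"
proof (rule convexI)
  fix x y and u v :: real
  assume "x \<in> {x \<in> S. f x \<le> c}" "y \<in> {x \<in> S. f x \<le> c}" and uv: "0 \<le> u" "0 \<le> v" "u + v = 1"
  then have xy: "x \<in> S" "y \<in> S" "f x \<le> c" "f y \<le> c" by auto
  have "f (u *\<^sub>R x + v *\<^sub>R y) \<le> u * f x + v * f y"
    using assms xy uv unfolding convex_on_def by blast
  also have "\<dots> \<le> u * c + v * c"
    using xy uv by (intro add_mono mult_left_mono)
  also have "\<dots> = c" using uv by (simp flip: distrib_right)
  finally show "u *\<^sub>R x + v *\<^sub>R y \<in> {x \<in> S. f x \<le> c}"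
    using convexD[OF convex_on_imp_convex[OF assms] xy(1,2) uv] by simp
qed

text \<open>\<open>proj\<close> is defined by choice; attainment of the distance makes the chosen
  point a closest one.\<close>

lemma proj_closest:
  fixes X :: "'a::real_inner set"
  assumes "complete X" "X \<noteq> {}" "convex X"
  shows "proj X x \<in> X" and "y \<in> X \<Longrightarrow> norm (x - proj X x) \<le> norm (x - y)"
proof -
  obtain p where "is_arg_min (\<lambda>y. norm (x - y)) (\<lambda>y. y \<in> X) p"
    using closest_point_exists_complete[OF assms, of x] by (auto simp: is_arg_min_linorder)
  then have "is_arg_min (\<lambda>y. norm (x - y)) (\<lambda>y. y \<in> X) (proj X x)"
    unfolding proj_def arg_min_def by (rule someI)
  then show "proj X x \<in> X" and "y \<in> X \<Longrightarrow> norm (x - proj X x) \<le> norm (x - y)"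
    by (auto simp: is_arg_min_linorder)
qed

lemma average_has_derivative:
  fixes V :: "'a::real_inner set"
  assumes "\<And>i. i \<in> {1..n} \<Longrightarrow> (F i has_derivative (\<lambda>h. inner (G i) h)) (at x within V)"
  shows "(average n F has_derivative (\<lambda>h. inner ((1 / real n) *\<^sub>R (\<Sum>i\<in>{1..n}. G i)) h)) (at x within V)"
proof -
  have "((\<lambda>x. 1 / real n * (\<Sum>i\<in>{1..n}. F i x)) has_derivative
      (\<lambda>h. 1 / real n * (\<Sum>i\<in>{1..n}. inner (G i) h))) (at x within V)"
    by (intro has_derivative_mult_right has_derivative_sum assms)
  then show ?thesis
    by (simp add: average_def[abs_def] inner_sum_left)
qed

section \<open>The interpolated problem and its Moreau envelope\<close>

text \<open>Coordinates are left behind: only a complete subspace V is kept. Here \<open>L\<close>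
  is a common Lipschitz constant of the gradients of all \<open>F i\<close>, later instantiated with
  \<open>Lmax\<close>.\<close>

locale interpolated_problem =
  fixes V :: "'a::real_inner set" and n :: nat and F :: "nat \<Rightarrow> 'a \<Rightarrow> real"
    and L :: real and xs :: 'a and \<gamma> :: real
  assumes V: "complete V" "subspace V"
    and n: "n \<ge> 1"
    and convex: "i \<in> {1..n} \<Longrightarrow> convex_on V (F i)"
    and differentiable: "i \<in> {1..n} \<Longrightarrow> F i differentiable_on V"
    and lipschitz: "i \<in> {1..n} \<Longrightarrow> L-lipschitz_on V (gradient_on V (F i))"
    and xs: "xs \<in> V" "i \<in> {1..n} \<Longrightarrow> gradient_on V (F i) xs = 0"
    and \<gamma>: "\<gamma> > 0"
begin

definition P :: "nat \<Rightarrow> 'a \<Rightarrow> 'a" where "P i x = prox V \<gamma> (F i) x"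

definition g :: "nat \<Rightarrow> 'a \<Rightarrow> 'a" where "g i x = (1 / \<gamma>) *\<^sub>R (x - P i x)"

text \<open>\<open>gradient_M\<close> identifies this average with the gradient of \<open>M\<close>
  on V.\<close>

definition grad :: "'a \<Rightarrow> 'a" where "grad x = (1 / real n) *\<^sub>R (\<Sum>i\<in>{1..n}. g i x)"

abbreviation M :: "'a \<Rightarrow> real" where "M \<equiv> average n (\<lambda>i. moreau V \<gamma> (F i))"

abbreviation X :: "'a set" where "X \<equiv> common_critical V n F"

lemma L_nonneg: "0 \<le> L"
  using lipschitz_on_nonneg[OF lipschitz[of 1]] n by simp

section \<open>The common solution set\<close>

lemma X_subset: "q \<in> X \<Longrightarrow> q \<in> V"
  by (simp add: common_critical_def)

lemma xs_in_X: "xs \<in> X"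
  using xs by (simp add: common_critical_def)

lemma gradient_F:
  assumes "i \<in> {1..n}" "z \<in> V"
  shows "gradient_on V (F i) z \<in> V"
    and "(F i has_derivative (\<lambda>h. inner (gradient_on V (F i) z) h)) (at z within V)"
  using gradient_on_has_derivative[OF V assms(2), of "F i"] differentiable[OF assms(1)] assms(2)
  by (simp_all add: differentiable_on_def)

lemma F_lower:
  assumes "i \<in> {1..n}" "z \<in> V" "w \<in> V"
  shows "F i w + inner (gradient_on V (F i) w) (z - w) \<le> F i z"
  by (rule convex_on_gradient_lower[OF V(2) assms(3,2) convex[OF assms(1)] gradient_F(2)[OF assms(1,3)]])

lemma X_minimizes:
  assumes "i \<in> {1..n}" "q \<in> X" "z \<in> V"
  shows "F i q \<le> F i z"
  using F_lower[OF assms(1,3) X_subset[OF assms(2)]] assms by (simp add: common_critical_def)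

text \<open>As an intersection of sublevel sets the solution set is visibly convex. A point of all
  these sets minimizes each \<open>F i\<close>, so its derivative along its own gradient
  vanishes.\<close>

lemma X_eq: "X = {x \<in> V. \<forall>i\<in>{1..n}. F i x \<le> F i xs}"
proof (intro set_eqI iffI)
  fix x assume "x \<in> X"
  then show "x \<in> {x \<in> V. \<forall>i\<in>{1..n}. F i x \<le> F i xs}"
    using X_minimizes xs X_subset by simp
next
  fix x assume x: "x \<in> {x \<in> V. \<forall>i\<in>{1..n}. F i x \<le> F i xs}"
  have "gradient_on V (F i) x = 0" if i: "i \<in> {1..n}" for i
  proof -
    let ?h = "gradient_on V (F i) x"
    have "?h \<in> V" using gradient_F(1)[OF i] x by simp
    have "((\<lambda>s. F i (x + s *\<^sub>R ?h)) has_real_derivative inner ?h ?h) (at 0)"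
      by (rule has_field_derivative_along_line[OF V(2)]) (use x \<open>?h \<in> V\<close> gradient_F(2)[OF i] in auto)
    moreover have "F i x \<le> F i (x + s *\<^sub>R ?h)" for s
      using X_minimizes[OF i xs_in_X, of "x + s *\<^sub>R ?h"] x i \<open>?h \<in> V\<close> V(2)
      by (force simp: subspace_add subspace_scale)
    ultimately have "inner ?h ?h = 0"
      by (intro DERIV_local_min[OF _ zero_less_one]) auto
    then show ?thesis by simp
  qed
  then show "x \<in> X" using x by (simp add: common_critical_def)
qed

lemma convex_X: "convex X"
proof -
  have "X = V \<inter> (\<Inter>i\<in>{1..n}. {x \<in> V. F i x \<le> F i xs})" unfolding X_eq by auto
  then show ?thesis
    using subspace_imp_convex[OF V(2)]
    by (auto intro!: convex_Int convex_INT convex_sublevel convex)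
qed

text \<open>Continuity of the gradients makes X closed in V.\<close>

lemma complete_X: "complete X"
  unfolding complete_def
proof (intro allI impI)
  fix Z assume Z: "(\<forall>k. Z k \<in> X) \<and> Cauchy Z"
  then obtain z where z: "z \<in> V" "Z \<longlonglongrightarrow> z"
    using V(1) X_subset unfolding complete_def by blast
  have "gradient_on V (F i) z = 0" if i: "i \<in> {1..n}" for i
  proof (rule LIMSEQ_unique)
    show "(\<lambda>k. gradient_on V (F i) (Z k)) \<longlonglongrightarrow> gradient_on V (F i) z"
      using continuous_on_tendsto_compose[OF lipschitz_on_continuous_on[OF lipschitz[OF i]] z(2,1)]
        Z X_subset by simp
    show "(\<lambda>k. gradient_on V (F i) (Z k)) \<longlonglongrightarrow> 0"
      using Z i by (simp add: common_critical_def)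
  qed
  then show "\<exists>z\<in>X. Z \<longlonglongrightarrow> z" using z by (auto simp: common_critical_def)
qed

lemmas proj_X = proj_closest[OF complete_X ex_in_conv[THEN iffD1, OF exI, OF xs_in_X] convex_X]

section \<open>The averaged envelope and its gradient\<close>

lemma prox_F:
  assumes "i \<in> {1..n}" "x \<in> V"
  shows "P i x \<in> V"
    and "z \<in> V \<Longrightarrow> F i (P i x) + 1 / (2 * \<gamma>) * (norm (P i x - x))\<^sup>2
      \<le> F i z + 1 / (2 * \<gamma>) * (norm (z - x))\<^sup>2"
  unfolding P_def
  using prox_minimizer[OF V assms(2) convex[OF assms(1)] \<gamma> gradient_F(2)[OF assms(1)]
      X_minimizes[OF assms(1) xs_in_X]] by simp_all

lemma moreau_F:
  assumes "i \<in> {1..n}" "x \<in> V"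
  shows "moreau V \<gamma> (F i) x = F i (P i x) + 1 / (2 * \<gamma>) * (norm (P i x - x))\<^sup>2"
  unfolding P_def by (rule moreau_eq_prox) (use prox_F[OF assms] in \<open>simp_all add: P_def\<close>)

lemma g_in_V: "i \<in> {1..n} \<Longrightarrow> x \<in> V \<Longrightarrow> g i x \<in> V"
  unfolding g_def using prox_F(1) V(2) by (simp add: subspace_diff subspace_scale)

lemma gradient_P:
  assumes "i \<in> {1..n}" "x \<in> V"
  shows "gradient_on V (F i) (P i x) = g i x"
  unfolding g_def
  by (rule gradient_at_prox[OF V(2) assms(2) prox_F(1)[OF assms] \<gamma> gradient_F[OF assms(1) prox_F(1)[OF assms]]
        prox_F(2)[OF assms]])

lemma grad_in_V: "x \<in> V \<Longrightarrow> grad x \<in> V"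
  unfolding grad_def using g_in_V V(2) by (intro subspace_scale subspace_sum) auto

lemma inner_grad: "(1 / real n) * (\<Sum>i\<in>{1..n}. inner (g i x) z) = inner (grad x) z"
  by (simp add: grad_def inner_sum_left)

text \<open>Convexity of \<open>M\<close> in gradient form, inherited from the tangent inequality of
  \<open>F i\<close> between the two proximal points.\<close>

lemma M_lower:
  assumes "x \<in> V" "y \<in> V"
  shows "M x + inner (grad x) (y - x) \<le> M y"
proof -
  have "moreau V \<gamma> (F i) x + inner (g i x) (y - x) \<le> moreau V \<gamma> (F i) y" if i: "i \<in> {1..n}" for i
    unfolding moreau_F[OF i assms(1)] moreau_F[OF i assms(2)] g_def
    using F_lower[OF i prox_F(1)[OF i assms(2)] prox_F(1)[OF i assms(1)]]
    by (intro moreau_lower_bound[OF \<gamma>]) (simp add: gradient_P[OF i assms(1)] g_def)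
  from average_mono[of n, OF this] show ?thesis
    by (simp add: average_def sum.distrib distrib_left inner_grad[symmetric])
qed

lemma M_upper:
  assumes "x \<in> V" "y \<in> V"
  shows "M y \<le> M x + inner (grad x) (y - x) + 1 / (2 * \<gamma>) * (norm (y - x))\<^sup>2"
proof -
  have "moreau V \<gamma> (F i) y \<le> moreau V \<gamma> (F i) x + inner (g i x) (y - x)
      + 1 / (2 * \<gamma>) * (norm (y - x))\<^sup>2" if i: "i \<in> {1..n}" for i
    unfolding moreau_F[OF i assms(1)] moreau_F[OF i assms(2)] g_def
    by (intro moreau_upper_bound[OF \<gamma>] prox_F(2)[OF i assms(2)] prox_F(1)[OF i assms(1)])
  from average_mono[of n, OF this] show ?thesis
    using n unfolding inner_grad[symmetric]
    by (simp add: average_def sum.distrib add_divide_distrib)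
qed

lemma M_has_derivative:
  assumes "x \<in> V"
  shows "(M has_derivative (\<lambda>h. inner (grad x) h)) (at x within V)"
  by (rule has_derivative_of_quadratic_bounds[OF V(2) assms M_lower[OF assms] M_upper[OF assms]])

lemma gradient_M: "x \<in> V \<Longrightarrow> gradient_on V M x = grad x"
  by (rule gradient_on_eq[OF V(2) _ grad_in_V M_has_derivative])

text \<open>Cocoercivity of the gradient of \<open>F i\<close> is applied at \<open>P i x\<close>.
  Substituting \<open>P i x = x - \<gamma> *\<^sub>R g i x\<close> moves a multiple of |g i x|^2 to
  the left, which improves the constant from L to L / (1 + \<gamma> L).\<close>

lemma g_cocoercive:
  assumes i: "i \<in> {1..n}" and x: "x \<in> V" and q: "q \<in> X"
  shows "(norm (g i x))\<^sup>2 \<le> L / (1 + \<gamma> * L) * inner (g i x) (x - q)"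
proof -
  have "(norm (g i x))\<^sup>2 \<le> L * inner (g i x) (P i x - q)"
    using critical_cocoercive[OF V(2) prox_F(1)[OF i x] X_subset[OF q] _ F_lower[OF i] gradient_F[OF i] lipschitz[OF i]]
      q i gradient_P[OF i x] by (simp add: common_critical_def)
  also have "P i x - q = (x - q) - \<gamma> *\<^sub>R g i x" using \<gamma> by (simp add: g_def)
  finally have "(1 + \<gamma> * L) * (norm (g i x))\<^sup>2 \<le> L * inner (g i x) (x - q)"
    by (simp add: inner_diff_right[of _ "x - q"] power2_norm_eq_inner algebra_simps del: diff_diff_eq)
  moreover have "1 + \<gamma> * L > 0" using \<gamma> L_nonneg by (simp add: add_pos_nonneg)
  ultimately show ?thesis by (simp add: field_simps)
qed

lemma g_at_X: "i \<in> {1..n} \<Longrightarrow> q \<in> X \<Longrightarrow> g i q = 0"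
  using g_cocoercive[of i q q] X_subset by simp

lemma grad_at_X: "q \<in> X \<Longrightarrow> grad q = 0"
  by (simp add: grad_def g_at_X)

lemma M_minimal: "q \<in> X \<Longrightarrow> x \<in> V \<Longrightarrow> M q \<le> M x"
  using M_lower[of q x] X_subset grad_at_X by simp

text \<open>Averaged cocoercivity forces every \<open>g i x\<close> to vanish, so every proximal map
  fixes x. This turns the critical point of \<open>M\<close> found by gradient descent into a
  solution.\<close>

lemma grad_zero_imp_X:
  assumes "x \<in> V" "grad x = 0"
  shows "x \<in> X"
proof -
  have "L / (1 + \<gamma> * L) \<ge> 0" using \<gamma> L_nonneg by simp
  have "(1 / real n) * (\<Sum>i\<in>{1..n}. (norm (g i x))\<^sup>2)
      \<le> (1 / real n) * (\<Sum>i\<in>{1..n}. L / (1 + \<gamma> * L) * inner (g i x) (x - xs))"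
    by (rule average_mono) (rule g_cocoercive[OF _ assms(1) xs_in_X])
  also have "\<dots> = L / (1 + \<gamma> * L) * inner (grad x) (x - xs)"
    unfolding sum_distrib_left[symmetric] inner_grad[symmetric] by (simp only: mult.left_commute)
  finally have "(\<Sum>i\<in>{1..n}. (norm (g i x))\<^sup>2) \<le> 0"
    using n assms(2) by (simp add: divide_le_0_iff)
  then have "(\<Sum>i\<in>{1..n}. (norm (g i x))\<^sup>2) = 0"
    by (meson antisym sum_nonneg zero_le_power2)
  then have g0: "g i x = 0" if "i \<in> {1..n}" for i
    using that by (subst (asm) sum_nonneg_eq_0_iff) auto
  then have "P i x = x" if "i \<in> {1..n}" for i
    using that \<gamma> by (force simp: g_def)
  then have "gradient_on V (F i) x = 0" if "i \<in> {1..n}" for i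
    using gradient_P[OF that assms(1)] g0 that by simp
  then show ?thesis using assms(1) by (simp add: common_critical_def)
qed

text \<open>The descent lemma for f at q, where its gradient vanishes. Distances to X thus control
  the gap with the smoothness constant of f itself.\<close>

lemma average_gap_le:
  assumes "L_smooth_on V Lf (average n F)" "x \<in> V" "q \<in> X"
  shows "average n F x - average n F xs \<le> Lf / 2 * (norm (x - q))\<^sup>2"
proof -
  let ?f = "average n F"
  have d: "(?f has_derivative (\<lambda>h. inner (gradient_on V ?f z) h)) (at z within V)" if "z \<in> V" for z
    using gradient_on_has_derivative(2)[OF V that, of ?f] assms(1) that
    by (simp add: L_smooth_on_def differentiable_on_def)
  have "(?f has_derivative (\<lambda>h. inner ((1 / real n) *\<^sub>R (\<Sum>i\<in>{1..n}. gradient_on V (F i) q)) h)) (at q within V)"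
    by (intro average_has_derivative gradient_F X_subset assms)
  then have "(?f has_derivative (\<lambda>h. inner 0 h)) (at q within V)"
    using assms(3) by (simp add: common_critical_def)
  from gradient_on_eq[OF V(2) X_subset[OF assms(3)] subspace_0[OF V(2)] this]
  have "?f x \<le> ?f q + Lf / 2 * (norm (x - q))\<^sup>2"
    using lipschitz_gradient_upper[OF V(2) X_subset[OF assms(3)] assms(2) d] assms(1)
    by (simp add: L_smooth_on_def)
  moreover have "?f q \<le> ?f xs"
    unfolding average_def by (rule average_mono) (rule X_minimizes[OF _ assms(3) xs(1)])
  ultimately show ?thesis by simp
qed

lemma grad_cocoercive:
  assumes "L_smooth_on V L\<gamma> M" "x \<in> V" "q \<in> X"
  shows "(norm (grad x))\<^sup>2 \<le> L\<gamma> * inner (grad x) (x - q)"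
proof (rule critical_cocoercive[OF V(2) assms(2) X_subset[OF assms(3)] grad_at_X[OF assms(3)] M_lower grad_in_V
      M_has_derivative])
  have "L\<gamma>-lipschitz_on V (gradient_on V M)"
    using assms(1) by (simp add: L_smooth_on_def)
  then show "L\<gamma>-lipschitz_on V grad"
    using gradient_M by (simp cong: lipschitz_on_cong)
qed

text \<open>The limit of gradient descent on \<open>M\<close> lies in X, so the projection is at
  least as close to x.\<close>

lemma quadratic_growth:
  assumes "L_smooth_on V L\<gamma> M" "L\<gamma> > 0" "\<mu> > 0" "x \<in> V"
    and pl: "\<And>z. z \<in> V \<Longrightarrow> \<mu> * (M z - M xs) \<le> 1 / 2 * (norm (gradient_on V M z))\<^sup>2"
  shows "\<mu> / 8 * (norm (x - proj X x))\<^sup>2 \<le> M x - M xs"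
proof -
  have "L\<gamma>-lipschitz_on V grad"
    using assms(1) gradient_M by (simp add: L_smooth_on_def cong: lipschitz_on_cong)
  then obtain y where y: "y \<in> V" "grad y = 0" "\<mu> / 8 * (norm (x - y))\<^sup>2 \<le> M x - M xs"
    using gradient_descent_pl[OF V assms(4) grad_in_V M_has_derivative _ assms(2) M_minimal[OF xs_in_X] assms(3)]
      pl gradient_M by metis
  have "norm (x - proj X x) \<le> norm (x - y)"
    by (rule proj_X(2)[OF grad_zero_imp_X[OF y(1,2)]])
  then have "\<mu> / 8 * (norm (x - proj X x))\<^sup>2 \<le> \<mu> / 8 * (norm (x - y))\<^sup>2"
    using assms(3) by (simp add: power_mono)
  with y(3) show ?thesis by linarith
qed

section \<open>Convergence of the iterates\<close>

definition step :: "nat \<Rightarrow> real \<Rightarrow> 'a \<Rightarrow> nat set \<Rightarrow> 'a" where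
  "step S \<alpha> x T = x + \<alpha> *\<^sub>R ((1 / real S) *\<^sub>R (\<Sum>i\<in>T. prox V \<gamma> (F i) x) - x)"

lemma step_in_V:
  assumes "x \<in> V" "T \<subseteq> {1..n}"
  shows "step S \<alpha> x T \<in> V"
  unfolding step_def using assms prox_F(1) V(2)
  by (intro subspace_add subspace_scale subspace_diff subspace_sum) (auto simp: P_def)

text \<open>As x minus its proximal point is \<gamma> \<open>g i x\<close>, the factor \<gamma>
  cancels and the update is a stochastic gradient step of size 1 / \<Lambda>.\<close>

lemma step_eq:
  assumes "card T = S" "S \<ge> 1"
  shows "step S (1 / (\<gamma> * \<Lambda>)) x T = x - (1 / (\<Lambda> * real S)) *\<^sub>R (\<Sum>i\<in>T. g i x)"
proof -
  have "(\<Sum>i\<in>T. g i x) = (1 / \<gamma>) *\<^sub>R (real S *\<^sub>R x - (\<Sum>i\<in>T. prox V \<gamma> (F i) x))"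
    using assms(1) by (simp add: g_def P_def scaleR_sum_right[symmetric] sum_subtractf sum_constant_scaleR)
  then show ?thesis
    using assms(2) by (simp add: step_def scaleR_diff_right mult.commute)
qed

text \<open>The double sum is the squared norm of the sampled sum. Its diagonal is bounded through
  \<open>g_cocoercive\<close>, the full sum, n^2 |grad x|^2, through
  \<open>grad_cocoercive\<close>.\<close>

lemma expected_sq_norm_sum_g_le:
  assumes n2: "n \<ge> 2" and S: "1 \<le> S" "S \<le> n" and smooth: "L_smooth_on V L\<gamma> M"
    and x: "x \<in> V" and q: "q \<in> X"
  shows "measure_pmf.expectation (nice_sampling n S) (\<lambda>T. \<Sum>i\<in>T. \<Sum>j\<in>T. inner (g i x) (g j x))
    \<le> (real S)\<^sup>2 * nice_smoothness n S \<gamma> L L\<gamma> * inner (grad x) (x - q)"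
proof -
  define p where "p = inner (grad x) (x - q)"
  have diag: "(\<Sum>i\<in>{1..n}. inner (g i x) (g i x)) \<le> real n * (L / (1 + \<gamma> * L) * p)"
  proof -
    have "(\<Sum>i\<in>{1..n}. inner (g i x) (g i x))
        \<le> (\<Sum>i\<in>{1..n}. L / (1 + \<gamma> * L) * inner (g i x) (x - q))"
      using g_cocoercive[OF _ x q] by (intro sum_mono) (simp add: power2_norm_eq_inner)
    also have "\<dots> = L / (1 + \<gamma> * L) * (real n * p)"
      unfolding sum_distrib_left[symmetric] p_def inner_grad[symmetric] using n by simp
    finally show ?thesis by (simp add: mult.left_commute)
  qed
  have "(\<Sum>i\<in>{1..n}. \<Sum>j\<in>{1..n}. inner (g i x) (g j x)) = (real n)\<^sup>2 * (norm (grad x))\<^sup>2"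
    unfolding inner_sum_right[symmetric] inner_sum_left[symmetric] grad_def power2_norm_eq_inner
    using n by (simp add: power2_eq_square)
  also have "\<dots> \<le> (real n)\<^sup>2 * (L\<gamma> * p)"
    unfolding p_def by (intro mult_left_mono grad_cocoercive[OF smooth x q]) simp
  finally have full: "(\<Sum>i\<in>{1..n}. \<Sum>j\<in>{1..n}. inner (g i x) (g j x)) \<le> (real n)\<^sup>2 * (L\<gamma> * p)" .
  have "measure_pmf.expectation (nice_sampling n S) (\<lambda>T. \<Sum>i\<in>T. \<Sum>j\<in>T. inner (g i x) (g j x))
    \<le> real S * (real n - real S) / (real n * (real n - 1)) * (real n * (L / (1 + \<gamma> * L) * p))
      + real S * (real S - 1) / (real n * (real n - 1)) * ((real n)\<^sup>2 * (L\<gamma> * p))"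
    unfolding nice_sampling_expectation_double_sum[OF S n2]
    using n2 S by (intro add_mono mult_left_mono diag full) auto
  also have "\<dots> = real S * (real n - real S) / (real n - 1) * (L / (1 + \<gamma> * L)) * p
      + real S * real n * (real S - 1) / (real n - 1) * L\<gamma> * p"
    using n2 by (simp add: power2_eq_square mult_ac)
  also have "\<dots> = (real S)\<^sup>2 * nice_smoothness n S \<gamma> L L\<gamma> * p"
    using S unfolding nice_smoothness_def distrib_left distrib_right
    by (simp add: power2_eq_square mult.assoc)
  finally show ?thesis unfolding p_def .
qed

lemma expected_step_contraction:
  assumes n2: "n \<ge> 2" and S: "1 \<le> S" "S \<le> n" and smooth: "L_smooth_on V L\<gamma> M" "L\<gamma> > 0" and "\<mu> > 0"
    and pl: "\<And>z. z \<in> V \<Longrightarrow> \<mu> * (M z - M xs) \<le> 1 / 2 * (norm (gradient_on V M z))\<^sup>2"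
    and \<Lambda>: "\<Lambda> = nice_smoothness n S \<gamma> L L\<gamma>" "\<Lambda> > 0" and x: "x \<in> V"
  shows "measure_pmf.expectation (nice_sampling n S)
      (\<lambda>T. (norm (step S (1 / (\<gamma> * \<Lambda>)) x T - proj X (step S (1 / (\<gamma> * \<Lambda>)) x T)))\<^sup>2)
    \<le> (1 - \<mu> / (8 * \<Lambda>)) * (norm (x - proj X x))\<^sup>2"
proof -
  let ?E = "measure_pmf.expectation (nice_sampling n S)"
  define q where "q = proj X x"
  have q: "q \<in> X" unfolding q_def by (rule proj_X(1))
  define p where "p = inner (grad x) (x - q)"
  define lin where "lin T = (\<Sum>i\<in>T. inner (g i x) (x - q))" for T
  define quad where "quad T = (\<Sum>i\<in>T. \<Sum>j\<in>T. inner (g i x) (g j x))" for T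
  define bound where "bound T = (norm (x - q))\<^sup>2 - 2 / (\<Lambda> * real S) * lin T + 1 / (\<Lambda> * real S)\<^sup>2 * quad T" for T
  have int: "integrable (measure_pmf (nice_sampling n S)) h" for h :: "nat set \<Rightarrow> real"
    by (rule integrable_measure_pmf_finite) (simp add: set_nice_sampling[OF S(2)] finite_nice_family)
  have "(norm (step S (1 / (\<gamma> * \<Lambda>)) x T - proj X (step S (1 / (\<gamma> * \<Lambda>)) x T)))\<^sup>2 \<le> bound T"
    if T: "T \<subseteq> {1..n}" "card T = S" for T
  proof -
    define c where "c = 1 / (\<Lambda> * real S)"
    define s where "s = (\<Sum>i\<in>T. g i x)"
    \<comment> \<open>The projection q of the old point still belongs to X and bounds the distance
      of the new point from X.\<close>
    have "(norm (step S (1 / (\<gamma> * \<Lambda>)) x T - proj X (step S (1 / (\<gamma> * \<Lambda>)) x T)))\<^sup>2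
        \<le> (norm (step S (1 / (\<gamma> * \<Lambda>)) x T - q))\<^sup>2"
      by (intro power_mono proj_X(2) q) simp
    also have "step S (1 / (\<gamma> * \<Lambda>)) x T - q = (x - q) - c *\<^sub>R s"
      using step_eq[OF T(2) S(1)] by (simp add: c_def s_def)
    also have "(norm ((x - q) - c *\<^sub>R s))\<^sup>2 = (norm (x - q))\<^sup>2 - 2 * c * inner s (x - q) + c\<^sup>2 * inner s s"
      unfolding power2_norm_eq_inner
      by (simp only: inner_diff_left[of "x - q"] inner_diff_right[of _ "x - q"] inner_scaleR_left
          inner_scaleR_right inner_commute[of "x - q" s])
        (simp add: power2_eq_square algebra_simps)
    also have "\<dots> = bound T"
      unfolding bound_def lin_def quad_def inner_sum_right[symmetric] inner_sum_left[symmetric]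
      by (simp add: s_def c_def power_divide)
    finally show ?thesis .
  qed
  then have "?E (\<lambda>T. (norm (step S (1 / (\<gamma> * \<Lambda>)) x T - proj X (step S (1 / (\<gamma> * \<Lambda>)) x T)))\<^sup>2) \<le> ?E bound"
    by (intro integral_mono_AE int) (simp add: AE_measure_pmf_iff set_nice_sampling[OF S(2)])
  also have "?E bound = (norm (x - q))\<^sup>2 - 2 / (\<Lambda> * real S) * ?E lin + 1 / (\<Lambda> * real S)\<^sup>2 * ?E quad"
    unfolding bound_def using int by simp
  also have "?E lin = real S * p"
    unfolding lin_def nice_sampling_expectation_sum[OF S] p_def inner_grad[symmetric] by simp
  \<comment> \<open>The second moment costs at most p / \<Lambda>, half of the linear gain 2 p /
    \<Lambda>.\<close>
  also have "1 / (\<Lambda> * real S)\<^sup>2 * ?E quad \<le> 1 / (\<Lambda> * real S)\<^sup>2 * ((real S)\<^sup>2 * \<Lambda> * p)"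
    unfolding quad_def p_def \<Lambda>(1)
    by (intro mult_left_mono expected_sq_norm_sum_g_le[OF n2 S smooth(1) x q]) simp
  also have "1 / (\<Lambda> * real S)\<^sup>2 * ((real S)\<^sup>2 * \<Lambda> * p) = p / \<Lambda>"
    using S \<Lambda>(2) by (simp add: power2_eq_square)
  also have "2 / (\<Lambda> * real S) * (real S * p) = 2 * (p / \<Lambda>)" using S by simp
  finally have "?E (\<lambda>T. (norm (step S (1 / (\<gamma> * \<Lambda>)) x T - proj X (step S (1 / (\<gamma> * \<Lambda>)) x T)))\<^sup>2)
      \<le> (norm (x - q))\<^sup>2 - p / \<Lambda>" by simp
  moreover have "\<mu> / 8 * (norm (x - q))\<^sup>2 \<le> p"
  proof -
    have "M x + inner (grad x) (q - x) \<le> M q" by (rule M_lower[OF x X_subset[OF q]])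
    moreover have "M q \<le> M xs" by (rule M_minimal[OF q xs(1)])
    ultimately have "M x - M xs \<le> p" by (simp add: p_def inner_diff_right)
    with quadratic_growth[OF smooth \<open>\<mu> > 0\<close> x pl] show ?thesis by (simp add: q_def)
  qed
  then have "\<mu> / 8 * (norm (x - q))\<^sup>2 / \<Lambda> \<le> p / \<Lambda>"
    using \<Lambda>(2) by (intro divide_right_mono) auto
  ultimately show ?thesis by (simp add: q_def algebra_simps)
qed

text \<open>Finite support settles integrability and turns expectations into finite sums; lying in V
  lets the pointwise estimates apply to every iterate.\<close>

lemma fedexprox_support:
  assumes "S \<le> n" "x0 \<in> V"
  shows "finite (set_pmf (fedexprox V n S F \<gamma> \<alpha> x0 k)) \<and> set_pmf (fedexprox V n S F \<gamma> \<alpha> x0 k) \<subseteq> V"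
proof (induction k)
  case (Suc k)
  then show ?case
    using finite_nice_family[of n S] step_in_V[unfolded step_def]
    by (auto simp: set_nice_sampling[OF assms(1)])
qed (use assms in simp)

lemma fedexprox_expected_distance:
  assumes n2: "n \<ge> 2" and S: "1 \<le> S" "S \<le> n" and smooth: "L_smooth_on V L\<gamma> M" "L\<gamma> > 0" and "\<mu> > 0"
    and pl: "\<And>z. z \<in> V \<Longrightarrow> \<mu> * (M z - M xs) \<le> 1 / 2 * (norm (gradient_on V M z))\<^sup>2"
    and \<Lambda>: "\<Lambda> = nice_smoothness n S \<gamma> L L\<gamma>" "\<Lambda> > 0" and x0: "x0 \<in> V"
  shows "measure_pmf.expectation (fedexprox V n S F \<gamma> (1 / (\<gamma> * \<Lambda>)) x0 k) (\<lambda>x. (norm (x - proj X x))\<^sup>2)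
    \<le> exp (- (real k * (\<mu> / (8 * \<Lambda>)))) * (norm (x0 - proj X x0))\<^sup>2"
proof (induction k)
  case (Suc k)
  define r where "r x = (norm (x - proj X x))\<^sup>2" for x
  define p where "p = fedexprox V n S F \<gamma> (1 / (\<gamma> * \<Lambda>)) x0 k"
  define \<rho> where "\<rho> = \<mu> / (8 * \<Lambda>)"
  have fin: "finite (set_pmf p)" and sub: "set_pmf p \<subseteq> V"
    using fedexprox_support[OF S(2) x0] by (simp_all add: p_def)
  have "measure_pmf.expectation (fedexprox V n S F \<gamma> (1 / (\<gamma> * \<Lambda>)) x0 (Suc k)) r
      = measure_pmf.expectation (bind_pmf p (\<lambda>x. map_pmf (step S (1 / (\<gamma> * \<Lambda>)) x) (nice_sampling n S))) r"
    by (simp add: p_def step_def[abs_def])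
  also have "\<dots> = (\<Sum>x\<in>set_pmf p. pmf p x *\<^sub>R
      measure_pmf.expectation (map_pmf (step S (1 / (\<gamma> * \<Lambda>)) x) (nice_sampling n S)) r)"
    by (rule pmf_expectation_bind[OF fin]) (auto simp: set_nice_sampling[OF S(2)] finite_nice_family)
  also have "\<dots> \<le> (\<Sum>x\<in>set_pmf p. pmf p x *\<^sub>R (exp (- \<rho>) * r x))"
  proof (intro sum_mono scaleR_left_mono)
    fix x assume "x \<in> set_pmf p"
    then have "measure_pmf.expectation (map_pmf (step S (1 / (\<gamma> * \<Lambda>)) x) (nice_sampling n S)) r
        \<le> (1 - \<rho>) * r x"
      using expected_step_contraction[OF n2 S smooth \<open>\<mu> > 0\<close> pl \<Lambda>, of x] sub
      by (auto simp: r_def \<rho>_def)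
    \<comment> \<open>Passing to the exponential in each step keeps the factor positive, so the
      contractions multiply without bounding \<rho> by 1.\<close>
    also have "\<dots> \<le> exp (- \<rho>) * r x"
      using exp_ge_add_one_self[of "- \<rho>"] by (intro mult_right_mono) (simp_all add: r_def)
    finally show "measure_pmf.expectation (map_pmf (step S (1 / (\<gamma> * \<Lambda>)) x) (nice_sampling n S)) r
        \<le> exp (- \<rho>) * r x" .
  qed simp
  also have "\<dots> = exp (- \<rho>) * (\<Sum>x\<in>set_pmf p. pmf p x *\<^sub>R r x)"
    by (simp add: sum_distrib_left mult.left_commute)
  also have "(\<Sum>x\<in>set_pmf p. pmf p x *\<^sub>R r x) = measure_pmf.expectation p r"
    by (rule integral_measure_pmf[symmetric, OF fin]) (simp add: set_pmf_eq)
  also have "exp (- \<rho>) * measure_pmf.expectation p r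
      \<le> exp (- \<rho>) * (exp (- (real k * \<rho>)) * (norm (x0 - proj X x0))\<^sup>2)"
    using Suc.IH by (intro mult_left_mono) (simp_all add: p_def r_def[abs_def] \<rho>_def)
  also have "\<dots> = exp (- (real (Suc k) * \<rho>)) * (norm (x0 - proj X x0))\<^sup>2"
    by (simp add: exp_add[symmetric] algebra_simps flip: mult.assoc)
  finally show ?case by (simp only: r_def[abs_def] \<rho>_def)
qed simp

end

section \<open>From exponential decay to the iteration bound\<close>

lemma exp_decay_le:
  fixes A \<rho> \<epsilon> k :: real
  assumes "\<rho> > 0" "0 < \<epsilon>" "\<epsilon> \<le> 1 / 2"
    and k: "(1 + ln (max 1 A) / ln 2) * (1 / \<rho>) * ln (1 / \<epsilon>) \<le> k"
  shows "A * exp (- (k * \<rho>)) \<le> \<epsilon>"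
proof -
  \<comment> \<open>The maximum with 1 makes \<open>ln m\<close> nonnegative and allows A to be
    0.\<close>
  define m where "m = max 1 A"
  have m: "m \<ge> 1" "A \<le> m" by (simp_all add: m_def)
  have "ln 2 \<le> ln (1 / \<epsilon>)" using assms by (simp add: field_simps)
  \<comment> \<open>The quotient is at least 1 because \<epsilon> \<le> 1 / 2; so the cost
    \<open>ln m\<close> of the initial value is absorbed into the constant.\<close>
  then have "ln m * 1 \<le> ln m * (ln (1 / \<epsilon>) / ln 2)"
    using m(1) by (intro mult_left_mono) auto
  then have "ln (1 / \<epsilon>) + ln m \<le> (1 + ln m / ln 2) * ln (1 / \<epsilon>)"
    by (simp add: algebra_simps)
  also have "\<dots> \<le> k * \<rho>"
    using k \<open>\<rho> > 0\<close> by (simp add: m_def field_simps)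
  finally have "exp (- (k * \<rho>)) \<le> exp (- (ln (1 / \<epsilon>) + ln m))" by simp
  also have "\<dots> = \<epsilon> / m"
    using assms(2) m(1) by (simp add: exp_diff exp_minus ln_div)
  finally have "m * exp (- (k * \<rho>)) \<le> \<epsilon>" using m(1) by (simp add: field_simps)
  moreover have "A * exp (- (k * \<rho>)) \<le> m * exp (- (k * \<rho>))" using m(2) by simp
  ultimately show ?thesis by linarith
qed

text \<open>Quantifying \<open>C\<close> first and applying it to L and D alone expresses that the
  constant depends only on these, uniformly in the dimension.\<close>

theorem theorem7p5:
  shows "\<exists>C :: real \<Rightarrow> real \<Rightarrow> real.
    \<forall>(d::nat) (n::nat) (S::nat) (F :: nat \<Rightarrow> fseq \<Rightarrow> real) (Li :: nat \<Rightarrow> real) (Lmax::real)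
      (f :: fseq \<Rightarrow> real) (L::real) (xstar::fseq) (\<gamma>::real) (M :: fseq \<Rightarrow> real) (\<mu>::real)
      (L\<^sub>\<gamma>::real) (L\<^sub>\<gamma>\<^sub>S::real) (x0::fseq) (D::real).
      d \<ge> 1 \<and> n \<ge> 2 \<and> S \<in> {1..n} \<and>
      f = average n F \<and>
      (\<forall>i\<in>{1..n}. closed (epigraph (Rspace d) (F i)) \<and> convex_on (Rspace d) (F i) \<and>
         F i differentiable_on Rspace d \<and> L_smooth_on (Rspace d) (Li i) (F i)) \<and>
      Lmax = Max (Li ` {1..n}) \<and>
      L_smooth_on (Rspace d) L f \<and>
      (\<exists>y\<in>Rspace d. \<forall>x\<in>Rspace d. f y \<le> f x) \<and>
      xstar \<in> Rspace d \<and> (\<forall>i\<in>{1..n}. gradient_on (Rspace d) (F i) xstar = 0) \<and>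
      \<gamma> > 0 \<and>
      M = average n (\<lambda>i. moreau (Rspace d) \<gamma> (F i)) \<and>
      \<mu> > 0 \<and>
      (\<forall>x\<in>Rspace d. 1 / 2 * (norm (gradient_on (Rspace d) M x))\<^sup>2 \<ge> \<mu> * (M x - M xstar)) \<and>
      L\<^sub>\<gamma> > 0 \<and> L_smooth_on (Rspace d) L\<^sub>\<gamma> M \<and>
      L\<^sub>\<gamma>\<^sub>S = nice_smoothness n S \<gamma> Lmax L\<^sub>\<gamma> \<and> L\<^sub>\<gamma>\<^sub>S > 0 \<and>
      x0 \<in> Rspace d \<and>
      D = norm (x0 - proj (common_critical (Rspace d) n F) x0)
      \<longrightarrow>
      (\<forall>\<epsilon> K. 0 < \<epsilon> \<and> \<epsilon> \<le> 1 / 2 \<and> real K \<ge> C L D * (L\<^sub>\<gamma>\<^sub>S / \<mu>) * ln (1 / \<epsilon>) \<longrightarrow>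
         measure_pmf.expectation
           (fedexprox (Rspace d) n S F \<gamma> (1 / (\<gamma> * L\<^sub>\<gamma>\<^sub>S)) x0 K) f - f xstar \<le> \<epsilon>)"
\<comment> \<open>The 8 comes from the contraction factor 1 - \<mu> / (8 \<Lambda>), and L / 2 * D^2
  bounds the initial gap of f.\<close>
proof (intro exI[of _ "\<lambda>L D. 8 * (1 + ln (max 1 (L / 2 * D\<^sup>2)) / ln 2)"] allI impI; elim conjE)
  fix d n S :: nat and F :: "nat \<Rightarrow> fseq \<Rightarrow> real" and Li :: "nat \<Rightarrow> real" and Lmax :: real
    and f :: "fseq \<Rightarrow> real" and L :: real and xstar :: fseq and \<gamma> :: real and M :: "fseq \<Rightarrow> real"
    and \<mu> Lg Lgs :: real and x0 :: fseq and D \<epsilon> :: real and K :: nat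
  let ?V = "Rspace d"
  assume n2: "n \<ge> 2" and S: "S \<in> {1..n}" and f: "f = average n F"
    and F: "\<forall>i\<in>{1..n}. closed (epigraph ?V (F i)) \<and> convex_on ?V (F i) \<and>
         F i differentiable_on ?V \<and> L_smooth_on ?V (Li i) (F i)"
    and Lmax: "Lmax = Max (Li ` {1..n})" and L: "L_smooth_on ?V L f"
    and xstar: "xstar \<in> ?V" "\<forall>i\<in>{1..n}. gradient_on ?V (F i) xstar = 0" and \<gamma>: "\<gamma> > 0"
    and M: "M = average n (\<lambda>i. moreau ?V \<gamma> (F i))" and \<mu>: "\<mu> > 0"
    and pl: "\<forall>x\<in>?V. 1 / 2 * (norm (gradient_on ?V M x))\<^sup>2 \<ge> \<mu> * (M x - M xstar)"
    and Lg: "Lg > 0" "L_smooth_on ?V Lg M"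
    and Lgs: "Lgs = nice_smoothness n S \<gamma> Lmax Lg" "Lgs > 0"
    and x0: "x0 \<in> ?V" and D: "D = norm (x0 - proj (common_critical ?V n F) x0)"
    and \<epsilon>: "0 < \<epsilon>" "\<epsilon> \<le> 1 / 2"
    and K: "real K \<ge> 8 * (1 + ln (max 1 (L / 2 * D\<^sup>2)) / ln 2) * (Lgs / \<mu>) * ln (1 / \<epsilon>)"
  interpret interpolated_problem ?V n F Lmax xstar \<gamma>
  proof
    fix i assume i: "i \<in> {1..n}"
    have "Li i \<le> Lmax" unfolding Lmax using i by (intro Max_ge) auto
    then show "Lmax-lipschitz_on ?V (gradient_on ?V (F i))"
      using F i unfolding L_smooth_on_def by (blast intro: lipschitz_on_le)
  qed (use complete_Rspace subspace_Rspace n2 F xstar \<gamma> in auto)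
  let ?p = "fedexprox ?V n S F \<gamma> (1 / (\<gamma> * Lgs)) x0 K"
  let ?r = "\<lambda>x. (norm (x - proj X x))\<^sup>2"
  define \<rho> where "\<rho> = \<mu> / (8 * Lgs)"
  have \<rho>: "\<rho> > 0" using \<mu> Lgs(2) by (simp add: \<rho>_def)
  have supp: "finite (set_pmf ?p)" "set_pmf ?p \<subseteq> ?V"
    using fedexprox_support[OF _ x0, of S] S by auto
  note int = integrable_measure_pmf_finite[OF supp(1)]
  have L0: "L \<ge> 0" using L lipschitz_on_nonneg unfolding L_smooth_on_def by blast
  have "measure_pmf.expectation ?p f - f xstar = measure_pmf.expectation ?p (\<lambda>x. f x - f xstar)"
    by (simp add: int)
  also have "\<dots> \<le> measure_pmf.expectation ?p (\<lambda>x. L / 2 * ?r x)"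
  proof (rule integral_mono_AE[OF int int])
    show "AE x in measure_pmf ?p. f x - f xstar \<le> L / 2 * ?r x"
      using supp(2) average_gap_le[OF L[unfolded f] _ proj_X(1)] unfolding f AE_measure_pmf_iff by blast
  qed
  also have "\<dots> = L / 2 * measure_pmf.expectation ?p ?r" by simp
  also have "\<dots> \<le> L / 2 * (exp (- (real K * \<rho>)) * D\<^sup>2)"
    using fedexprox_expected_distance[OF n2 _ _ Lg(2)[unfolded M] Lg(1) \<mu> _ Lgs x0, of K] S pl L0
    by (intro mult_left_mono) (simp_all add: M D \<rho>_def)
  also have "\<dots> = (L / 2 * D\<^sup>2) * exp (- (real K * \<rho>))" by simp
  also have "\<dots> \<le> \<epsilon>"
    using K by (intro exp_decay_le[OF \<rho> \<epsilon>]) (simp add: \<rho>_def mult_ac)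
  finally show "measure_pmf.expectation ?p f - f xstar \<le> \<epsilon>" .
qed

end
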